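(* Let $U$ be a neighborhood of the origin $o\in\mathbb{R}^2$ and let $h:U\to\mathbb{L}^3$ be a $C^\infty$-differentiable time-like surface which has no umbilics on $U\setminus\{o\}$ and which has a curvature line flow $\mathcal{F}$ on $U\setminus\{o\}$. If $h$ has no quasi-umbilics on $U\setminus\{o\}$, then the index of the flow $\mathcal{F}$ at $o$ is equal to zero. In particular, if the Gaussian curvature of $h$ is negative on $U\setminus\{o\}$, then the index of $\mathcal{F}$ at $o$ vanishes.
   Context: $\mathbb{L}^3$ is the Lorentz-Minkowski 3-space, i.e. $\mathbb{R}^3$ with the inner product $x_1y_1+x_2y_2-x_3y_3$ (signature $(++-)$). A time-like surface is an immersion $h:U\to\mathbb{L}^3$ whose induced metric is Lorentzian. With $\nu$ a unit normal field ($\nu\cdot\nu=1$), the shape operator $A_h$ is defined by $d\nu=-dh\circ A_h$. An umbilic is a point where $A_h$ is a scalar multiple of the identity; a quasi-umbilic is a point where the characteristic equation of $A_h$ has a double root but $A_h$ is not diagonalizable. The Gaussian curvature of $h$ is that of the induced Lorentzian metric, which equals $\det A_h$; its sign is opposite to that of the Gaussian curvature of the same surface regarded in Euclidean 3-space. A principal direction is a (real) eigen-direction of $A_h$. A curvature line flow on $U\setminus\{o\}$ is the flow (foliation) generated by a continuous field of principal directions (1-dimensional tangent subspaces) on $U\setminus\{o\}$. Its index at $o$ is the total variation of the angle of the direction along a small counterclockwise circle around $o$, divided by $2\pi$, an element of $\frac12\mathbb{Z}$. *)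

theory Defs
  imports "HOL-Analysis.Analysis" "HOL-Computational_Algebra.Polynomial"
begin

text \<open>Partial derivatives and \<open>C\<^sup>\<infinity>\<close> maps. The predicates are meant for open sets.\<close>

definition partial :: "2 \<Rightarrow> (real^2 \<Rightarrow> 'b::real_normed_vector) \<Rightarrow> real^2 \<Rightarrow> 'b" where
  "partial i f p = frechet_derivative f (at p) (axis i 1)"

fun Ck_on :: "nat \<Rightarrow> ('a::euclidean_space \<Rightarrow> 'b::real_normed_vector) \<Rightarrow> 'a set \<Rightarrow> bool" where
  "Ck_on 0 f S \<longleftrightarrow> continuous_on S f"
| "Ck_on (Suc k) f S \<longleftrightarrow>
     (\<forall>x\<in>S. f differentiable (at x)) \<and> (\<forall>v. Ck_on k (\<lambda>x. frechet_derivative f (at x) v) S)"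

definition smooth_on :: "('a::euclidean_space \<Rightarrow> 'b::real_normed_vector) \<Rightarrow> 'a set \<Rightarrow> bool" where
  "smooth_on f S \<longleftrightarrow> (\<forall>k. Ck_on k f S)"

definition lorentz_inner :: "real^3 \<Rightarrow> real^3 \<Rightarrow> real" where
  "lorentz_inner x y = x$1 * y$1 + x$2 * y$2 - x$3 * y$3"

definition induced_metric :: "(real^2 \<Rightarrow> real^3) \<Rightarrow> real^2 \<Rightarrow> real^2 \<Rightarrow> real^2 \<Rightarrow> real" where
  "induced_metric h p v w =
     lorentz_inner (frechet_derivative h (at p) v) (frechet_derivative h (at p) w)"

definition lorentzian_form :: "(real^2 \<Rightarrow> real^2 \<Rightarrow> real) \<Rightarrow> bool" where
  "lorentzian_form B \<longleftrightarrow>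
     bilinear B \<and> (\<forall>v w. B v w = B w v) \<and>
     (\<exists>e1 e2. B e1 e1 = 1 \<and> B e2 e2 = -1 \<and> B e1 e2 = 0)"

definition timelike_surface :: "(real^2 \<Rightarrow> real^3) \<Rightarrow> (real^2) set \<Rightarrow> bool" where
  "timelike_surface h U \<longleftrightarrow>
     open U \<and> smooth_on h U \<and>
     (\<forall>p\<in>U. inj (frechet_derivative h (at p)) \<and> lorentzian_form (induced_metric h p))"

definition unit_normal_field ::
    "(real^2 \<Rightarrow> real^3) \<Rightarrow> (real^2) set \<Rightarrow> (real^2 \<Rightarrow> real^3) \<Rightarrow> bool" where
  "unit_normal_field h U \<nu> \<longleftrightarrow>
     smooth_on \<nu> U \<and>
     (\<forall>p\<in>U. lorentz_inner (\<nu> p) (\<nu> p) = 1 \<and>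
            (\<forall>v. lorentz_inner (\<nu> p) (frechet_derivative h (at p) v) = 0))"

text \<open>
  The endomorphism \<open>A\<close> of the tangent plane at \<open>p\<close> (identified with the coordinate plane via
  the differential of \<open>h\<close>) with \<open>d\<nu> = - dh \<circ> A\<close>. It exists because \<open>d\<nu>\<close> is orthogonal to \<open>\<nu>\<close>,
  and is unique because \<open>dh\<close> is injective.
\<close>
definition shape_operator ::
    "(real^2 \<Rightarrow> real^3) \<Rightarrow> (real^2 \<Rightarrow> real^3) \<Rightarrow> real^2 \<Rightarrow> real^2 \<Rightarrow> real^2" where
  "shape_operator h \<nu> p =
     (THE A. linear A \<and>
        (\<forall>v. frechet_derivative \<nu> (at p) v = - frechet_derivative h (at p) (A v)))"

definition diagonalizable :: "(real^2 \<Rightarrow> real^2) \<Rightarrow> bool" where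
  "diagonalizable A \<longleftrightarrow>
     (\<exists>B. independent B \<and> span B = UNIV \<and> (\<forall>b\<in>B. \<exists>c. A b = c *\<^sub>R b))"

definition characteristic_poly :: "(real^2 \<Rightarrow> real^2) \<Rightarrow> real poly" where
  "characteristic_poly A = det (mat [:0, 1:] - (\<chi> i j. [:matrix A $ i $ j:]) :: real poly ^2^2)"

definition umbilic ::
    "(real^2 \<Rightarrow> real^3) \<Rightarrow> (real^2 \<Rightarrow> real^3) \<Rightarrow> real^2 \<Rightarrow> bool" where
  "umbilic h \<nu> p \<longleftrightarrow> (\<exists>c. \<forall>v. shape_operator h \<nu> p v = c *\<^sub>R v)"

definition quasi_umbilic ::
    "(real^2 \<Rightarrow> real^3) \<Rightarrow> (real^2 \<Rightarrow> real^3) \<Rightarrow> real^2 \<Rightarrow> bool" where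
  "quasi_umbilic h \<nu> p \<longleftrightarrow>
     (\<exists>c. order c (characteristic_poly (shape_operator h \<nu> p)) = 2) \<and>
     \<not> diagonalizable (shape_operator h \<nu> p)"

text \<open>
  Gaussian curvature of a nondegenerate metric \<open>g\<close> given by its coefficient matrices:
  \<open>christoffel g k i j\<close> is \<open>\<Gamma>\<^sup>k\<^sub>i\<^sub>j\<close>, \<open>riemann g l i j k\<close> is the \<open>l\<close>-th component of
  \<open>R(\<partial>\<^sub>i, \<partial>\<^sub>j)\<partial>\<^sub>k\<close>, and the curvature is \<open>g(R(\<partial>\<^sub>1, \<partial>\<^sub>2)\<partial>\<^sub>2, \<partial>\<^sub>1) / det g\<close>.
\<close>

definition christoffel :: "(real^2 \<Rightarrow> real^2^2) \<Rightarrow> 2 \<Rightarrow> 2 \<Rightarrow> 2 \<Rightarrow> real^2 \<Rightarrow> real" where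
  "christoffel g k i j p =
     (\<Sum>l\<in>UNIV. matrix_inv (g p) $ k $ l *
        (partial i (\<lambda>q. g q $ j $ l) p + partial j (\<lambda>q. g q $ i $ l) p
          - partial l (\<lambda>q. g q $ i $ j) p)) / 2"

definition riemann :: "(real^2 \<Rightarrow> real^2^2) \<Rightarrow> 2 \<Rightarrow> 2 \<Rightarrow> 2 \<Rightarrow> 2 \<Rightarrow> real^2 \<Rightarrow> real" where
  "riemann g l i j k p =
     partial i (christoffel g l j k) p - partial j (christoffel g l i k) p
     + (\<Sum>m\<in>UNIV. christoffel g m j k p * christoffel g l i m p
                - christoffel g m i k p * christoffel g l j m p)"

definition metric_curvature :: "(real^2 \<Rightarrow> real^2^2) \<Rightarrow> real^2 \<Rightarrow> real" where
  "metric_curvature g p = (\<Sum>l\<in>UNIV. g p $ l $ 1 * riemann g l 1 2 2 p) / det (g p)"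

definition gaussian_curvature :: "(real^2 \<Rightarrow> real^3) \<Rightarrow> real^2 \<Rightarrow> real" where
  "gaussian_curvature h =
     metric_curvature (\<lambda>p. \<chi> i j. induced_metric h p (axis i 1) (axis j 1))"

definition continuous_line_field_on :: "(real^2) set \<Rightarrow> (real^2 \<Rightarrow> (real^2) set) \<Rightarrow> bool" where
  "continuous_line_field_on S F \<longleftrightarrow>
     (\<forall>p\<in>S. \<exists>N X. open N \<and> p \<in> N \<and> continuous_on (N \<inter> S) X \<and>
        (\<forall>q\<in>N \<inter> S. X q \<noteq> (0::real^2) \<and> F q = span {X q}))"

definition principal_direction ::
    "(real^2 \<Rightarrow> real^3) \<Rightarrow> (real^2 \<Rightarrow> real^3) \<Rightarrow> real^2 \<Rightarrow> (real^2) set \<Rightarrow> bool" where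
  "principal_direction h \<nu> p L \<longleftrightarrow>
     subspace L \<and> dim L = 1 \<and> (\<exists>k. \<forall>v\<in>L. shape_operator h \<nu> p v = k *\<^sub>R v)"

definition curvature_line_flow ::
    "(real^2 \<Rightarrow> real^3) \<Rightarrow> (real^2 \<Rightarrow> real^3) \<Rightarrow> (real^2) set \<Rightarrow> (real^2 \<Rightarrow> (real^2) set) \<Rightarrow> bool" where
  "curvature_line_flow h \<nu> S F \<longleftrightarrow>
     continuous_line_field_on S F \<and> (\<forall>p\<in>S. principal_direction h \<nu> p (F p))"

definition angle_vec :: "real \<Rightarrow> real^2" where
  "angle_vec t = vector [cos t, sin t]"

text \<open>
  The index of \<open>F\<close> at \<open>p\<close> is \<open>i\<close>: along every sufficiently small circle around \<open>p\<close> the direction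
  has a continuous angle function, and its total variation is \<open>2 * pi * i\<close>.
\<close>
definition has_line_field_index :: "(real^2 \<Rightarrow> (real^2) set) \<Rightarrow> real^2 \<Rightarrow> real \<Rightarrow> bool" where
  "has_line_field_index F p i \<longleftrightarrow>
     (\<exists>\<epsilon>>0. \<forall>r. 0 < r \<and> r < \<epsilon> \<longrightarrow>
        (\<exists>\<theta>. continuous_on {0..2*pi} \<theta> \<and>
             (\<forall>t\<in>{0..2*pi}. F (p + r *\<^sub>R angle_vec t) = span {angle_vec (\<theta> t)}) \<and>
             i = (\<theta> (2*pi) - \<theta> 0) / (2*pi)))"

lemma span_angle_vec_eq_imp:
  assumes "span {angle_vec a} = span {angle_vec b}"
  shows "sin (a - b) = 0"
proof -
  have "angle_vec a \<in> span {angle_vec b}"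
    using assms span_base by blast
  then obtain k where "angle_vec a = k *\<^sub>R angle_vec b"
    by (auto simp: span_singleton)
  then have "cos a = k * cos b" "sin a = k * sin b"
    by (auto simp: angle_vec_def vec_eq_iff forall_2)
  then show ?thesis
    by (simp add: sin_diff)
qed

lemma has_line_field_index_unique:
  assumes "has_line_field_index F p i" "has_line_field_index F p j"
  shows "i = j"
proof -
  obtain d where d: "d > 0" "\<And>r. 0 < r \<Longrightarrow> r < d \<Longrightarrow>
        (\<exists>\<theta>. continuous_on {0..2*pi} \<theta> \<and>
             (\<forall>t\<in>{0..2*pi}. F (p + r *\<^sub>R angle_vec t) = span {angle_vec (\<theta> t)}) \<and>
             i = (\<theta> (2*pi) - \<theta> 0) / (2*pi))"
    using assms(1) unfolding has_line_field_index_def by blast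
  obtain e where e: "e > 0" "\<And>r. 0 < r \<Longrightarrow> r < e \<Longrightarrow>
        (\<exists>\<theta>. continuous_on {0..2*pi} \<theta> \<and>
             (\<forall>t\<in>{0..2*pi}. F (p + r *\<^sub>R angle_vec t) = span {angle_vec (\<theta> t)}) \<and>
             j = (\<theta> (2*pi) - \<theta> 0) / (2*pi))"
    using assms(2) unfolding has_line_field_index_def by blast
  define r where "r = min d e / 2"
  have r: "0 < r" "r < d" "r < e"
    using d(1) e(1) by (auto simp: r_def)
  obtain f where f: "continuous_on {0..2*pi} f"
      "\<And>t. t \<in> {0..2*pi} \<Longrightarrow> F (p + r *\<^sub>R angle_vec t) = span {angle_vec (f t)}"
      "i = (f (2*pi) - f 0) / (2*pi)"
    using d(2)[OF r(1,2)] by blast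
  obtain g where g: "continuous_on {0..2*pi} g"
      "\<And>t. t \<in> {0..2*pi} \<Longrightarrow> F (p + r *\<^sub>R angle_vec t) = span {angle_vec (g t)}"
      "j = (g (2*pi) - g 0) / (2*pi)"
    using e(2)[OF r(1,3)] by blast
  define u where "u t = (f t - g t) / pi" for t
  have u_int: "u t \<in> \<int>" if "t \<in> {0..2*pi}" for t
  proof -
    have "sin (f t - g t) = 0"
      using f(2)[OF that] g(2)[OF that] by (intro span_angle_vec_eq_imp) simp
    then obtain n :: int where "f t - g t = of_int n * pi"
      by (auto simp: sin_zero_iff_int2)
    then show ?thesis by (simp add: u_def)
  qed
  have cont: "continuous_on {0..2*pi} u"
    unfolding u_def by (intro continuous_intros f(1) g(1)) simp
  have "u constant_on {0..2*pi}"
  proof (rule continuous_discrete_range_constant[OF _ cont])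
    show "connected {0..2*pi}" by simp
    show "\<exists>e>0. \<forall>y. y \<in> {0..2*pi} \<and> u y \<noteq> u x \<longrightarrow> e \<le> norm (u y - u x)"
      if "x \<in> {0..2*pi}" for x
    proof (intro exI[of _ 1] conjI allI impI)
      fix y assume y: "y \<in> {0..2*pi} \<and> u y \<noteq> u x"
      then have "u y - u x \<in> \<int>" "u y - u x \<noteq> 0"
        using u_int that by auto
      then show "1 \<le> norm (u y - u x)"
        using Ints_nonzero_abs_ge1[of "u y - u x"] by simp
    qed simp
  qed
  then have "u (2*pi) = u 0"
    unfolding constant_on_def by (metis atLeastAtMost_iff order_refl pi_ge_zero zero_le_mult_iff zero_le_numeral)
  then have "f (2*pi) - g (2*pi) = f 0 - g 0"
    by (simp add: u_def)
  then have "f (2*pi) - f 0 = g (2*pi) - g 0" by simp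
  then show ?thesis using f(3) g(3) by simp
qed

end

theory Submission
  imports Defs
begin

text \<open>
  Let \<open>A\<close> be the shape operator and \<open>g\<close> the induced metric. Since \<open>A\<close> is self-adjoint with respect to the
  Lorentzian form \<open>g\<close>, a null principal direction forces \<open>A\<close> to have a double eigenvalue, so the point is
  an umbilic or a quasi-umbilic. Hence, when there are neither, the line field is nowhere null, and on a
  small punctured disc, which is connected, it is either everywhere space-like or everywhere time-like.
  By continuity of \<open>g\<close> at the origin, a fixed time-like (respectively space-like) vector of \<open>g\<close> at the
  origin keeps its causal type nearby, so the line field avoids a fixed direction. The angle of a
  line field that avoids a fixed direction is a single-valued continuous function on the punctured
  disc, so its variation along a circle is zero.

  If the Gaussian curvature is negative, the Gauss equation gives \<open>det A < 0\<close>, whereas at a quasi-umbilic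
  \<open>det A\<close> is the square of the double eigenvalue.
\<close>

section \<open>Smooth maps and symmetry of second derivatives\<close>

lemma smooth_on_imp_differentiable:
  assumes "smooth_on f S" "x \<in> S"
  shows "f differentiable (at x)"
  using assms Ck_on.simps(2)[of 0 f S] unfolding smooth_on_def by blast

lemma smooth_on_imp_continuous_on: "smooth_on f S \<Longrightarrow> continuous_on S f"
  using Ck_on.simps(1) unfolding smooth_on_def by blast

lemma smooth_on_frechet_derivative:
  assumes "smooth_on f S"
  shows "smooth_on (\<lambda>x. frechet_derivative f (at x) v) S"
  using assms Ck_on.simps(2) unfolding smooth_on_def by blast

lemma smooth_on_partial: "smooth_on f S \<Longrightarrow> smooth_on (partial i f) S"
  unfolding partial_def[abs_def] by (rule smooth_on_frechet_derivative)

section \<open>Mixed second derivatives of real-valued maps\<close>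

lemma has_real_derivative_along_line:
  fixes f :: "'a::real_normed_vector \<Rightarrow> real"
  assumes "f differentiable (at (p + s *\<^sub>R v))"
  shows "((\<lambda>s. f (p + s *\<^sub>R v)) has_real_derivative frechet_derivative f (at (p + s *\<^sub>R v)) v) (at s)"
proof -
  let ?D = "frechet_derivative f (at (p + s *\<^sub>R v))"
  have D: "(f has_derivative ?D) (at (p + s *\<^sub>R v))"
    using assms by (simp add: frechet_derivative_works)
  have "((\<lambda>s. p + s *\<^sub>R v) has_derivative (\<lambda>s. s *\<^sub>R v)) (at s)"
    by (auto intro!: derivative_eq_intros)
  from has_derivative_compose[OF this D]
  have "((\<lambda>s. f (p + s *\<^sub>R v)) has_derivative (\<lambda>x. ?D (x *\<^sub>R v))) (at s)" .
  moreover have "(\<lambda>x. ?D (x *\<^sub>R v)) = (*) (?D v)"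
    using linear_frechet_derivative[OF assms] by (auto simp: linear_cmul)
  ultimately show ?thesis by (simp add: has_field_derivative_def)
qed

text \<open>Two applications of the mean value theorem: first in direction \<open>v\<close>, to the
  increment of \<open>f\<close> across \<open>t *\<^sub>R w\<close>, then in direction
  \<open>w\<close>, to the \<open>v\<close>-derivative of \<open>f\<close>.\<close>

lemma second_difference_mvt:
  fixes f :: "'a::real_normed_vector \<Rightarrow> real"
  assumes t: "t > 0"
    and S: "\<And>s r. 0 \<le> s \<Longrightarrow> s \<le> t \<Longrightarrow> 0 \<le> r \<Longrightarrow> r \<le> t \<Longrightarrow> p + s *\<^sub>R v + r *\<^sub>R w \<in> S"
    and f: "\<And>x. x \<in> S \<Longrightarrow> f differentiable (at x)"
    and f': "\<And>x. x \<in> S \<Longrightarrow> (\<lambda>x. frechet_derivative f (at x) v) differentiable (at x)"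
  obtains s r where "0 < s" "s < t" "0 < r" "r < t"
    "f (p + t *\<^sub>R v + t *\<^sub>R w) - f (p + t *\<^sub>R v) - f (p + t *\<^sub>R w) + f p
      = t * t * frechet_derivative (\<lambda>x. frechet_derivative f (at x) v) (at (p + s *\<^sub>R v + r *\<^sub>R w)) w"
proof -
  let ?D = "\<lambda>x. frechet_derivative f (at x) v"
  define \<phi> where "\<phi> s = f (p + t *\<^sub>R w + s *\<^sub>R v) - f (p + s *\<^sub>R v)" for s
  have S': "p + s *\<^sub>R v \<in> S" "p + t *\<^sub>R w + s *\<^sub>R v \<in> S" if "0 \<le> s" "s \<le> t" for s
    using S[of s 0] S[of s t] that t by (auto simp: algebra_simps)
  have "(\<phi> has_real_derivative ?D (p + t *\<^sub>R w + s *\<^sub>R v) - ?D (p + s *\<^sub>R v)) (at s)"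
    if "0 \<le> s" "s \<le> t" for s
    unfolding \<phi>_def
    by (intro derivative_intros has_real_derivative_along_line f S' that)
  from MVT2[OF t this] obtain s where s: "0 < s" "s < t"
    "\<phi> t - \<phi> 0 = t * (?D (p + t *\<^sub>R w + s *\<^sub>R v) - ?D (p + s *\<^sub>R v))"
    by auto
  have "((\<lambda>r. ?D (p + s *\<^sub>R v + r *\<^sub>R w)) has_real_derivative
      frechet_derivative ?D (at (p + s *\<^sub>R v + r *\<^sub>R w)) w) (at r)"
    if "0 \<le> r" "r \<le> t" for r
    using s that by (intro has_real_derivative_along_line f' S) auto
  from MVT2[OF t this] obtain r where r: "0 < r" "r < t"
    "?D (p + s *\<^sub>R v + t *\<^sub>R w) - ?D (p + s *\<^sub>R v)
      = t * frechet_derivative ?D (at (p + s *\<^sub>R v + r *\<^sub>R w)) w"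
    by auto
  have "\<phi> t - \<phi> 0 = t * t * frechet_derivative ?D (at (p + s *\<^sub>R v + r *\<^sub>R w)) w"
    using s(3) r(3) by (simp add: add_ac)
  then show thesis
    using s(1,2) r(1,2) by (intro that[of s r]) (simp_all add: \<phi>_def algebra_simps)
qed

text \<open>The second difference of \<open>f\<close> over the parallelogram spanned by
  \<open>t *\<^sub>R v\<close> and \<open>t *\<^sub>R w\<close> is symmetric in the two sides. It
  equals \<open>t * t\<close> times either mixed derivative, each taken at some point of the
  parallelogram, so by continuity the two cannot differ at \<open>p\<close>.\<close>

lemma frechet_derivative_commute_real:
  fixes f :: "'a::euclidean_space \<Rightarrow> real"
  assumes U: "open U" "p \<in> U" and f: "smooth_on f U"
  shows "frechet_derivative (\<lambda>x. frechet_derivative f (at x) v) (at p) w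
       = frechet_derivative (\<lambda>x. frechet_derivative f (at x) w) (at p) v"
proof (rule ccontr)
  define L where "L = (\<lambda>x. frechet_derivative (\<lambda>x. frechet_derivative f (at x) v) (at x) w)"
  define R where "R = (\<lambda>x. frechet_derivative (\<lambda>x. frechet_derivative f (at x) w) (at x) v)"
  assume "\<not> ?thesis"
  then have ne: "L p \<noteq> R p" by (simp add: L_def R_def)
  \<comment> \<open>Half the gap: a value within \<open>e\<close> of \<open>L p\<close> cannot equal
    a value within \<open>e\<close> of \<open>R p\<close>.\<close>
  define e where "e = \<bar>L p - R p\<bar> / 2"
  have e: "e > 0" using ne by (simp add: e_def)
  have "continuous_on U L" "continuous_on U R"
    unfolding L_def R_def
    by (intro smooth_on_imp_continuous_on smooth_on_frechet_derivative f)+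
  then have "isCont L p" "isCont R p"
    using U continuous_on_eq_continuous_at by blast+
  then have "(L \<longlongrightarrow> L p) (nhds p)" "(R \<longlongrightarrow> R p) (nhds p)"
    by (simp_all add: isCont_def flip: tendsto_at_iff_tendsto_nhds)
  then have "\<forall>\<^sub>F x in nhds p. dist (L x) (L p) < e" "\<forall>\<^sub>F x in nhds p. dist (R x) (R p) < e"
    using e tendstoD by blast+
  moreover have "\<forall>\<^sub>F x in nhds p. x \<in> U"
    using U by (simp add: eventually_nhds_in_open)
  ultimately have "\<forall>\<^sub>F x in nhds p. dist (L x) (L p) < e \<and> dist (R x) (R p) < e \<and> x \<in> U"
    by eventually_elim auto
  then obtain d where d: "d > 0"
    "\<And>x. dist x p < d \<Longrightarrow> dist (L x) (L p) < e \<and> dist (R x) (R p) < e \<and> x \<in> U"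
    unfolding eventually_nhds_metric by blast
  \<comment> \<open>The whole parallelogram of scale \<open>t\<close> stays within
    \<open>d / 2\<close> of \<open>p\<close>; the summand 1 keeps \<open>N\<close> positive even for
    \<open>v = w = 0\<close>.\<close>
  define N where "N = norm v + norm w + 1"
  define t where "t = d / (2 * N)"
  have pos: "N > 0" by (simp add: N_def add_nonneg_pos)
  then have t: "t > 0" using d(1) by (simp add: t_def)
  have near: "dist (p + s *\<^sub>R v + r *\<^sub>R w) p < d"
    if "0 \<le> s" "s \<le> t" "0 \<le> r" "r \<le> t" for s r
  proof -
    have "dist (p + s *\<^sub>R v + r *\<^sub>R w) p = norm (s *\<^sub>R v + r *\<^sub>R w)"
      by (simp add: dist_norm add.assoc)
    also have "\<dots> \<le> s * norm v + r * norm w"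
      using that by (intro order_trans[OF norm_triangle_ineq]) simp
    also have "\<dots> \<le> t * norm v + t * norm w"
      using that by (intro add_mono mult_right_mono) auto
    also have "\<dots> \<le> t * N"
      using t by (simp add: N_def algebra_simps)
    also have "\<dots> = d / 2" using pos by (simp add: t_def)
    also have "\<dots> < d" using d(1) by simp
    finally show ?thesis .
  qed
  have near': "p + s *\<^sub>R v + r *\<^sub>R w \<in> ball p d" and near'': "p + r *\<^sub>R w + s *\<^sub>R v \<in> ball p d"
    if "0 \<le> s" "s \<le> t" "0 \<le> r" "r \<le> t" for s r
    using near[OF that] by (auto simp: dist_commute add_ac)
  have diff: "f differentiable (at x)" "(\<lambda>x. frechet_derivative f (at x) u) differentiable (at x)"
    if "x \<in> ball p d" for x u
    using that d(2)[of x] f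
    by (auto simp: dist_commute intro!: smooth_on_imp_differentiable[of _ U] smooth_on_frechet_derivative)
  obtain s r where sr: "0 < s" "s < t" "0 < r" "r < t"
    "f (p + t *\<^sub>R v + t *\<^sub>R w) - f (p + t *\<^sub>R v) - f (p + t *\<^sub>R w) + f p
      = t * t * L (p + s *\<^sub>R v + r *\<^sub>R w)"
    unfolding L_def R_def by (rule second_difference_mvt[where v = v and w = w, OF t near' diff])
  obtain s' r' where sr': "0 < s'" "s' < t" "0 < r'" "r' < t"
    "f (p + t *\<^sub>R w + t *\<^sub>R v) - f (p + t *\<^sub>R w) - f (p + t *\<^sub>R v) + f p
      = t * t * R (p + s' *\<^sub>R w + r' *\<^sub>R v)"
    unfolding L_def R_def by (rule second_difference_mvt[where v = w and w = v, OF t near'' diff])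
  have "L (p + s *\<^sub>R v + r *\<^sub>R w) = R (p + r' *\<^sub>R v + s' *\<^sub>R w)"
  proof -
    have swap: "p + t *\<^sub>R w + t *\<^sub>R v = p + t *\<^sub>R v + t *\<^sub>R w" "p + s' *\<^sub>R w + r' *\<^sub>R v = p + r' *\<^sub>R v + s' *\<^sub>R w"
      by (simp_all add: add_ac)
    have "t * t * L (p + s *\<^sub>R v + r *\<^sub>R w) = t * t * R (p + r' *\<^sub>R v + s' *\<^sub>R w)"
      using sr(5) sr'(5)[unfolded swap] by linarith
    then show ?thesis using t by simp
  qed
  moreover have "dist (L (p + s *\<^sub>R v + r *\<^sub>R w)) (L p) < e"
    "dist (R (p + r' *\<^sub>R v + s' *\<^sub>R w)) (R p) < e"
    using d(2) near sr sr' by auto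
  ultimately have "\<bar>L p - R p\<bar> < 2 * e"
    by (simp add: dist_real_def)
  then show False by (simp add: e_def)
qed

lemma frechet_derivative_inner_left:
  fixes f :: "'a::real_normed_vector \<Rightarrow> 'b::real_inner"
  assumes "f differentiable (at p)"
  shows "frechet_derivative (\<lambda>x. f x \<bullet> c) (at p) v = frechet_derivative f (at p) v \<bullet> c"
proof -
  have "((\<lambda>x. f x \<bullet> c) has_derivative (\<lambda>v. frechet_derivative f (at p) v \<bullet> c)) (at p)"
    using assms by (intro has_derivative_inner_left) (simp add: frechet_derivative_works)
  then show ?thesis by (simp flip: frechet_derivative_at)
qed

lemma frechet_derivative_cong_open:
  assumes "open U" "p \<in> U" "f differentiable (at p)" "\<And>x. x \<in> U \<Longrightarrow> f x = g x"
  shows "frechet_derivative f (at p) v = frechet_derivative g (at p) v"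
  using frechet_derivative_transform_within_open[of f p U g] assms by simp

lemma differentiable_cong_open:
  assumes "open U" "p \<in> U" "f differentiable (at p)" "\<And>x. x \<in> U \<Longrightarrow> f x = g x"
  shows "g differentiable (at p)"
  using assms has_derivative_transform_within_open[of f _ p UNIV U g]
  unfolding differentiable_def by auto

text \<open>On an open set the derivative at a point depends only on the values inside the set, so
  agreement passes to derivatives of every order.\<close>

lemma Ck_on_cong:
  assumes "open S" "\<And>x. x \<in> S \<Longrightarrow> f x = g x" "Ck_on k f S"
  shows "Ck_on k g S"
  using assms(2,3)
proof (induction k arbitrary: f g)
  case 0
  then show ?case by (simp cong: continuous_on_cong)
next
  case (Suc k)
  show ?case unfolding Ck_on.simps
  proof (intro conjI ballI allI)
    show "g differentiable (at x)" if "x \<in> S" for x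
      using differentiable_cong_open[OF assms(1) that, of f g] Suc.prems that by auto
    show "Ck_on k (\<lambda>x. frechet_derivative g (at x) v) S" for v
    proof (rule Suc.IH)
      show "frechet_derivative f (at x) v = frechet_derivative g (at x) v" if "x \<in> S" for x
        using Suc.prems that by (intro frechet_derivative_cong_open[OF assms(1)]) simp_all
      show "Ck_on k (\<lambda>x. frechet_derivative f (at x) v) S"
        using Suc.prems by simp
    qed
  qed
qed

lemma Ck_on_inner_left:
  fixes f :: "'a::euclidean_space \<Rightarrow> 'b::real_inner"
  assumes "open S" "Ck_on k f S"
  shows "Ck_on k (\<lambda>x. f x \<bullet> c) S"
  using assms(2)
proof (induction k arbitrary: f)
  case 0
  then show ?case by (auto intro!: continuous_on_inner continuous_on_const)
next
  case (Suc k)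
  show ?case unfolding Ck_on.simps
  proof (intro conjI ballI allI)
    show "(\<lambda>x. f x \<bullet> c) differentiable (at x)" if "x \<in> S" for x
      using Suc.prems that by (intro differentiable_inner) simp_all
    show "Ck_on k (\<lambda>x. frechet_derivative (\<lambda>x. f x \<bullet> c) (at x) v) S" for v
    proof (rule Ck_on_cong[OF assms(1)])
      show "frechet_derivative f (at x) v \<bullet> c = frechet_derivative (\<lambda>x. f x \<bullet> c) (at x) v"
        if "x \<in> S" for x
        using Suc.prems that by (simp add: frechet_derivative_inner_left)
      show "Ck_on k (\<lambda>x. frechet_derivative f (at x) v \<bullet> c) S"
        using Suc.prems by (intro Suc.IH) simp
    qed
  qed
qed

text \<open>Pairing with a fixed vector \<open>c\<close> commutes with differentiation, which
  reduces the claim to the real-valued case one component at a time.\<close>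

lemma frechet_derivative_commute:
  fixes f :: "'a::euclidean_space \<Rightarrow> 'b::euclidean_space"
  assumes U: "open U" "p \<in> U" and f: "smooth_on f U"
  shows "frechet_derivative (\<lambda>x. frechet_derivative f (at x) v) (at p) w
       = frechet_derivative (\<lambda>x. frechet_derivative f (at x) w) (at p) v"
proof (rule euclidean_eqI)
  fix c :: 'b
  have comp: "frechet_derivative (\<lambda>x. frechet_derivative f (at x) v) (at p) w \<bullet> c
    = frechet_derivative (\<lambda>x. frechet_derivative (\<lambda>x. f x \<bullet> c) (at x) v) (at p) w" for v w
  proof -
    have d: "(\<lambda>x. frechet_derivative f (at x) v) differentiable (at p)"
      by (rule smooth_on_imp_differentiable[OF smooth_on_frechet_derivative[OF f] U(2)])
    then have "(\<lambda>x. frechet_derivative f (at x) v \<bullet> c) differentiable (at p)"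
      by (intro differentiable_inner) auto
    from frechet_derivative_cong_open[OF U this,
        of "\<lambda>x. frechet_derivative (\<lambda>x. f x \<bullet> c) (at x) v" w]
    show ?thesis
      by (simp add: frechet_derivative_inner_left d smooth_on_imp_differentiable[OF f])
  qed
  have "smooth_on (\<lambda>x. f x \<bullet> c) U"
    using f U(1) by (simp add: smooth_on_def Ck_on_inner_left)
  from frechet_derivative_commute_real[OF U this]
  show "frechet_derivative (\<lambda>x. frechet_derivative f (at x) v) (at p) w \<bullet> c
     = frechet_derivative (\<lambda>x. frechet_derivative f (at x) w) (at p) v \<bullet> c"
    unfolding comp .
qed

section \<open>Calculus of coordinate partial derivatives\<close>

lemma partial_commute:
  fixes f :: "real^2 \<Rightarrow> 'b::euclidean_space"
  assumes "open U" "p \<in> U" "smooth_on f U"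
  shows "partial i (partial j f) p = partial j (partial i f) p"
  unfolding partial_def using frechet_derivative_commute[OF assms] .

lemma frechet_derivative_eq_partials:
  assumes "f differentiable (at p)"
  shows "frechet_derivative f (at p) v = v $ 1 *\<^sub>R partial 1 f p + v $ 2 *\<^sub>R partial 2 f p"
proof -
  have "v = v $ 1 *\<^sub>R axis 1 1 + v $ 2 *\<^sub>R axis 2 1"
    by (simp add: vec_eq_iff forall_2 axis_def)
  then have "frechet_derivative f (at p) v
    = frechet_derivative f (at p) (v $ 1 *\<^sub>R axis 1 1 + v $ 2 *\<^sub>R axis 2 1)"
    by (rule arg_cong)
  also have "\<dots> = v $ 1 *\<^sub>R partial 1 f p + v $ 2 *\<^sub>R partial 2 f p"
    using linear_frechet_derivative[OF assms] by (simp add: partial_def linear_add linear_cmul)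
  finally show ?thesis .
qed

lemma partial_cong_open:
  assumes "open U" "p \<in> U" "f differentiable (at p)" "\<And>x. x \<in> U \<Longrightarrow> f x = g x"
  shows "partial i f p = partial i g p"
  unfolding partial_def by (rule frechet_derivative_cong_open[OF assms])

lemma partial_eqI: "(f has_derivative f') (at p) \<Longrightarrow> partial i f p = f' (axis i 1)"
  unfolding partial_def by (simp flip: frechet_derivative_at)

lemma partial_add:
  assumes "f differentiable (at p)" "g differentiable (at p)"
  shows "partial i (\<lambda>x. f x + g x) p = partial i f p + partial i g p"
  using assms[unfolded frechet_derivative_works]
  by (simp add: partial_eqI[OF has_derivative_add] flip: partial_def)

lemma partial_scaleR:
  assumes "f differentiable (at p)" "g differentiable (at p)"
  shows "partial i (\<lambda>x. f x *\<^sub>R g x) p = partial i f p *\<^sub>R g p + f p *\<^sub>R partial i g p"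
  using assms[unfolded frechet_derivative_works]
  by (simp add: partial_eqI[OF has_derivative_scaleR] flip: partial_def)

section \<open>The Gauss equation\<close>

interpretation lorentz: bounded_bilinear lorentz_inner
  unfolding bilinear_conv_bounded_bilinear[symmetric]
  by (auto simp: bilinear_def linear_iff lorentz_inner_def algebra_simps)

lemma lorentz_inner_commute: "lorentz_inner x y = lorentz_inner y x"
  by (simp add: lorentz_inner_def mult.commute)

lemma differentiable_lorentz_inner:
  assumes "f differentiable (at p)" "g differentiable (at p)"
  shows "(\<lambda>q. lorentz_inner (f q) (g q)) differentiable (at p)"
  using assms lorentz.FDERIV unfolding differentiable_def by blast

lemma partial_lorentz_inner:
  assumes "f differentiable (at p)" "g differentiable (at p)"
  shows "partial i (\<lambda>q. lorentz_inner (f q) (g q)) p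
       = lorentz_inner (partial i f p) (g p) + lorentz_inner (f p) (partial i g p)"
  using assms[unfolded frechet_derivative_works]
  by (simp add: partial_eqI[OF lorentz.FDERIV] flip: partial_def)

text \<open>The hypotheses make the Gram determinant of \<open>n\<close>, \<open>a\<close>,
  \<open>b\<close> nonzero, so these vectors form a basis, and a vector orthogonal to a basis
  vanishes because the form is nondegenerate.\<close>

lemma lorentz_orthogonal_imp_zero:
  assumes "lorentz_inner n n = 1" "lorentz_inner n a = 0" "lorentz_inner n b = 0"
    and "lorentz_inner a a * lorentz_inner b b - (lorentz_inner a b)\<^sup>2 \<noteq> 0"
    and u: "lorentz_inner u a = 0" "lorentz_inner u b = 0" "lorentz_inner u n = 0"
  shows "u = 0"
proof -
  \<comment> \<open>This is the determinant with rows \<open>n\<close>, \<open>a\<close>,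
    \<open>b\<close>. The Gram determinant equals \<open>- d\<^sup>2\<close>, the sign coming from
    the signature.\<close>
  define d where "d = n$1 * (a$2 * b$3 - a$3 * b$2) - n$2 * (a$1 * b$3 - a$3 * b$1)
    + n$3 * (a$1 * b$2 - a$2 * b$1)"
  have "lorentz_inner n n * (lorentz_inner a a * lorentz_inner b b - (lorentz_inner a b)\<^sup>2)
      - lorentz_inner n a * (lorentz_inner n a * lorentz_inner b b - lorentz_inner a b * lorentz_inner n b)
      + lorentz_inner n b * (lorentz_inner n a * lorentz_inner a b - lorentz_inner a a * lorentz_inner n b)
      = - d\<^sup>2"
    unfolding lorentz_inner_def d_def power2_eq_square by (simp add: algebra_simps)
  then have "d \<noteq> 0" using assms(1-4) by auto
  \<comment> \<open>Cramer's rule for \<open>u\<close> in terms of its three products; the third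
    equation has the sign reversed since the form negates the third coordinate.\<close>
  have "d * u$1 = (a$2 * b$3 - a$3 * b$2) * lorentz_inner u n
      - (n$2 * b$3 - n$3 * b$2) * lorentz_inner u a + (n$2 * a$3 - n$3 * a$2) * lorentz_inner u b"
    "d * u$2 = - (a$1 * b$3 - a$3 * b$1) * lorentz_inner u n
      + (n$1 * b$3 - n$3 * b$1) * lorentz_inner u a - (n$1 * a$3 - n$3 * a$1) * lorentz_inner u b"
    "- d * u$3 = (a$1 * b$2 - a$2 * b$1) * lorentz_inner u n
      - (n$1 * b$2 - n$2 * b$1) * lorentz_inner u a + (n$1 * a$2 - n$2 * a$1) * lorentz_inner u b"
    unfolding lorentz_inner_def d_def by (simp_all add: algebra_simps)
  then show ?thesis using u \<open>d \<noteq> 0\<close> by (simp add: vec_eq_iff forall_3)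
qed

lemma matrix_inv_right_inverse:
  fixes M :: "real^'n^'n"
  assumes "det M \<noteq> 0"
  shows "M ** matrix_inv M = mat 1"
proof -
  have "\<exists>B. M ** B = mat 1 \<and> B ** M = mat 1"
    using assms by (simp add: invertible_det_nz flip: invertible_def)
  from someI_ex[OF this] show ?thesis by (simp add: matrix_inv_def)
qed

section \<open>First and second fundamental forms\<close>

locale timelike_immersion =
  fixes U :: "(real^2) set" and h \<nu> :: "real^2 \<Rightarrow> real^3"
  assumes timelike: "timelike_surface h U" and normal: "unit_normal_field h U \<nu>"
begin

lemma open_domain: "open U"
  and smooth_immersion: "smooth_on h U"
  using timelike by (auto simp: timelike_surface_def)

lemma smooth_normal: "smooth_on \<nu> U"
  using normal by (auto simp: unit_normal_field_def)

abbreviation tangent :: "2 \<Rightarrow> real^2 \<Rightarrow> real^3" where "tangent i \<equiv> partial i h"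

abbreviation metric :: "2 \<Rightarrow> 2 \<Rightarrow> real^2 \<Rightarrow> real" where
  "metric i j \<equiv> \<lambda>p. lorentz_inner (tangent i p) (tangent j p)"

abbreviation metric_matrix :: "real^2 \<Rightarrow> real^2^2" where
  "metric_matrix \<equiv> \<lambda>p. \<chi> i j. induced_metric h p (axis i 1) (axis j 1)"

definition second_form :: "2 \<Rightarrow> 2 \<Rightarrow> real^2 \<Rightarrow> real" where
  "second_form i j p = lorentz_inner (partial i (tangent j) p) (\<nu> p)"

lemma metric_matrix_nth: "metric_matrix p $ i $ j = metric i j p"
  by (simp add: induced_metric_def partial_def)

lemma metric_21: "metric 2 1 p = metric 1 2 p"
  by (rule lorentz_inner_commute)

lemma differentiable_immersion: "p \<in> U \<Longrightarrow> h differentiable (at p)"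
  and differentiable_tangent: "p \<in> U \<Longrightarrow> tangent i differentiable (at p)"
  and differentiable_tangent2: "p \<in> U \<Longrightarrow> partial i (tangent j) differentiable (at p)"
  and differentiable_normal: "p \<in> U \<Longrightarrow> \<nu> differentiable (at p)"
  by (auto intro: smooth_on_imp_differentiable smooth_on_partial smooth_immersion smooth_normal)

lemma induced_metric_eq:
  assumes "p \<in> U"
  shows "induced_metric h p v w = v$1 * w$1 * metric 1 1 p + (v$1 * w$2 + v$2 * w$1) * metric 1 2 p
    + v$2 * w$2 * metric 2 2 p"
  using metric_21[of p]
  by (simp add: induced_metric_def frechet_derivative_eq_partials[OF differentiable_immersion[OF assms]]
      lorentz.add_left lorentz.add_right lorentz.scaleR_left lorentz.scaleR_right algebra_simps)

text \<open>Under a change of frame the Gram determinant is multiplied by the square of the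
  transition determinant, and in a Lorentz-orthonormal frame it equals -1.\<close>

lemma det_metric_nonzero:
  assumes "p \<in> U"
  shows "metric 1 1 p * metric 2 2 p - (metric 1 2 p)\<^sup>2 \<noteq> 0"
proof -
  obtain e1 e2 where e: "induced_metric h p e1 e1 = 1" "induced_metric h p e2 e2 = -1"
    "induced_metric h p e1 e2 = 0"
    using timelike assms unfolding timelike_surface_def lorentzian_form_def by blast
  have "(metric 1 1 p * metric 2 2 p - (metric 1 2 p)\<^sup>2) * (e1$1 * e2$2 - e1$2 * e2$1)\<^sup>2
    = induced_metric h p e1 e1 * induced_metric h p e2 e2 - (induced_metric h p e1 e2)\<^sup>2"
    unfolding induced_metric_eq[OF assms] by algebra
  then show ?thesis using e by auto
qed

lemma det_metric_matrix:
  "det (metric_matrix p) = metric 1 1 p * metric 2 2 p - (metric 1 2 p)\<^sup>2"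
  unfolding det_2 metric_matrix_nth using metric_21[of p] by (simp add: power2_eq_square)

lemma normal_unit: "p \<in> U \<Longrightarrow> lorentz_inner (\<nu> p) (\<nu> p) = 1"
  and normal_tangent: "p \<in> U \<Longrightarrow> lorentz_inner (\<nu> p) (tangent i p) = 0"
  using normal by (auto simp: unit_normal_field_def partial_def)

text \<open>The coordinate tangents and the normal form a basis; vector identities below are proved
  by testing against it.\<close>

lemma tangent_normal_eq_zero_iff:
  assumes "p \<in> U"
  shows "u = 0 \<longleftrightarrow> lorentz_inner u (tangent 1 p) = 0 \<and> lorentz_inner u (tangent 2 p) = 0
    \<and> lorentz_inner u (\<nu> p) = 0"
  using lorentz_orthogonal_imp_zero[of "\<nu> p" "tangent 1 p" "tangent 2 p" u]
    assms normal_unit normal_tangent det_metric_nonzero lorentz.zero_left by auto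

lemma partial_const_on:
  assumes "p \<in> U" "f differentiable (at p)" "\<And>q. q \<in> U \<Longrightarrow> f q = c"
  shows "partial i f p = 0"
  using partial_cong_open[OF open_domain assms] by (simp add: partial_def)

lemma second_form_commute: "p \<in> U \<Longrightarrow> second_form i j p = second_form j i p"
  unfolding second_form_def using partial_commute[OF open_domain _ smooth_immersion] by simp

text \<open>Differentiate the orthogonality of \<open>\<nu>\<close> and
  \<open>tangent j\<close>.\<close>

lemma partial_normal_tangent:
  assumes "p \<in> U"
  shows "lorentz_inner (partial i \<nu> p) (tangent j p) = - second_form i j p"
proof -
  have d: "\<nu> differentiable (at p)" "tangent j differentiable (at p)"
    using assms differentiable_normal differentiable_tangent by auto
  have "partial i (\<lambda>q. lorentz_inner (\<nu> q) (tangent j q)) p = 0"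
    using assms normal_tangent by (intro partial_const_on differentiable_lorentz_inner d)
  then show ?thesis
    by (simp add: partial_lorentz_inner[OF d] second_form_def lorentz_inner_commute)
qed

text \<open>Differentiate the constant square norm of \<open>\<nu>\<close>.\<close>

lemma partial_normal_normal:
  assumes "p \<in> U"
  shows "lorentz_inner (partial i \<nu> p) (\<nu> p) = 0"
proof -
  note d = differentiable_normal[OF assms]
  have "partial i (\<lambda>q. lorentz_inner (\<nu> q) (\<nu> q)) p = 0"
    using assms normal_unit by (intro partial_const_on differentiable_lorentz_inner d)
  then show ?thesis
    by (simp add: partial_lorentz_inner[OF d d] lorentz_inner_commute)
qed

section \<open>Christoffel symbols, Gauss formula and Gauss equation\<close>

abbreviation chris :: "2 \<Rightarrow> 2 \<Rightarrow> 2 \<Rightarrow> real^2 \<Rightarrow> real" where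
  "chris \<equiv> christoffel metric_matrix"

text \<open>The product rule expands the three derivatives of the metric into six terms. By symmetry
  of the second derivatives of \<open>h\<close>, four of them cancel and the other two coincide,
  which absorbs the factor 1/2.\<close>

lemma christoffel_eq:
  assumes p: "p \<in> U"
  shows "chris k i j p
    = (\<Sum>l\<in>UNIV. matrix_inv (metric_matrix p) $ k $ l * lorentz_inner (partial i (tangent j) p) (tangent l p))"
proof -
  have d: "partial k (\<lambda>q. metric_matrix q $ i $ j) p
    = lorentz_inner (partial k (tangent i) p) (tangent j p) + lorentz_inner (tangent i p) (partial k (tangent j) p)"
    for k i j
    unfolding metric_matrix_nth by (simp add: partial_lorentz_inner differentiable_tangent[OF p])
  have c: "partial i (tangent j) p = partial j (tangent i) p" for i j
    by (rule partial_commute[OF open_domain p smooth_immersion])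
  have "partial i (\<lambda>q. metric_matrix q $ j $ l) p + partial j (\<lambda>q. metric_matrix q $ i $ l) p
      - partial l (\<lambda>q. metric_matrix q $ i $ j) p
    = 2 * lorentz_inner (partial i (tangent j) p) (tangent l p)" for l
    unfolding d c[of j i] c[of l i] c[of l j] by (simp add: lorentz_inner_commute)
  then show ?thesis
    unfolding christoffel_def by (simp add: sum_divide_distrib)
qed

lemma christoffel_lower:
  assumes p: "p \<in> U"
  shows "chris 1 i j p * metric 1 l p + chris 2 i j p * metric 2 l p
    = lorentz_inner (partial i (tangent j) p) (tangent l p)"
proof -
  let ?I = "matrix_inv (metric_matrix p)"
  have "metric_matrix p ** ?I = mat 1"
    using det_metric_nonzero[OF p] det_metric_matrix by (intro matrix_inv_right_inverse) simp
  then have "(metric_matrix p ** ?I) $ l $ m = (if l = m then 1 else 0)" for l m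
    by (simp add: mat_def)
  then have I: "metric l 1 p * ?I $ 1 $ m + metric l 2 p * ?I $ 2 $ m = (if l = m then 1 else 0)" for l m
    by (simp add: matrix_matrix_mult_def sum_2 metric_matrix_nth[simplified])
  let ?x = "\<lambda>l. lorentz_inner (partial i (tangent j) p) (tangent l p)"
  have "chris 1 i j p * metric 1 l p + chris 2 i j p * metric 2 l p
    = (metric l 1 p * ?I $ 1 $ 1 + metric l 2 p * ?I $ 2 $ 1) * ?x 1
    + (metric l 1 p * ?I $ 1 $ 2 + metric l 2 p * ?I $ 2 $ 2) * ?x 2"
    unfolding christoffel_eq[OF p] sum_2 lorentz_inner_commute[of _ "tangent l p"]
    by (simp add: algebra_simps)
  also have "\<dots> = ?x l"
    unfolding I using exhaust_2[of l] by auto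
  finally show ?thesis .
qed

text \<open>Both sides have the same product with each tangent, by \<open>christoffel_lower\<close>,
  and with the normal.\<close>

lemma gauss_formula:
  assumes p: "p \<in> U"
  shows "partial i (tangent j) p
    = chris 1 i j p *\<^sub>R tangent 1 p + chris 2 i j p *\<^sub>R tangent 2 p + second_form i j p *\<^sub>R \<nu> p"
proof -
  let ?r = "chris 1 i j p *\<^sub>R tangent 1 p + chris 2 i j p *\<^sub>R tangent 2 p + second_form i j p *\<^sub>R \<nu> p"
  have "lorentz_inner ?r (tangent l p) = lorentz_inner (partial i (tangent j) p) (tangent l p)" for l
    using christoffel_lower[OF p] normal_tangent[OF p]
    by (simp add: lorentz.add_left lorentz.scaleR_left)
  moreover have "lorentz_inner ?r (\<nu> p) = lorentz_inner (partial i (tangent j) p) (\<nu> p)"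
    using normal_tangent[OF p] normal_unit[OF p]
    by (simp add: lorentz.add_left lorentz.scaleR_left lorentz_inner_commute[of "tangent _ p" "\<nu> p"] second_form_def)
  ultimately have "partial i (tangent j) p - ?r = 0"
    unfolding tangent_normal_eq_zero_iff[OF p] by (simp add: lorentz.diff_left)
  then show ?thesis by simp
qed

text \<open>Instead of differentiating the inverse matrix, solve the 2 by 2 system of
  \<open>christoffel_lower\<close> by Cramer's rule: on \<open>U\<close> the symbols are quotients
  of differentiable functions with nonvanishing denominator.\<close>

lemma differentiable_christoffel:
  assumes p: "p \<in> U"
  shows "chris k i j differentiable (at p)"
proof -
  let ?x = "\<lambda>l q. lorentz_inner (partial i (tangent j) q) (tangent l q)"
  let ?d = "\<lambda>q. metric 1 1 q * metric 2 2 q - (metric 1 2 q)\<^sup>2"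
  let ?f = "\<lambda>q. if k = 1 then (?x 1 q * metric 2 2 q - ?x 2 q * metric 1 2 q) / ?d q
    else (?x 2 q * metric 1 1 q - ?x 1 q * metric 1 2 q) / ?d q"
  have x: "?x l differentiable (at p)" "metric l m differentiable (at p)" for l m
    using p by (auto intro!: differentiable_lorentz_inner differentiable_tangent differentiable_tangent2)
  have "?f differentiable (at p)"
    using det_metric_nonzero[OF p]
    by (cases "k = 1") (auto intro!: derivative_intros x)
  moreover have "?f q = chris k i j q" if q: "q \<in> U" for q
  proof -
    have e: "chris 1 i j q * metric 1 l q + chris 2 i j q * metric 2 l q = ?x l q" for l
      by (rule christoffel_lower[OF q])
    have "?x 1 q * metric 2 2 q - ?x 2 q * metric 1 2 q = chris 1 i j q * ?d q"
      "?x 2 q * metric 1 1 q - ?x 1 q * metric 1 2 q = chris 2 i j q * ?d q"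
      unfolding e[symmetric] metric_21 power2_eq_square by (simp_all add: algebra_simps)
    then show ?thesis
      using det_metric_nonzero[OF q] exhaust_2[of k] by (auto simp: nonzero_divide_eq_eq)
  qed
  ultimately show ?thesis
    by (rule differentiable_cong_open[OF open_domain p])
qed

text \<open>Differentiate the Gauss formula and pair with \<open>tangent m\<close>. The term along
  \<open>\<nu>\<close> drops out, while the derivative of \<open>\<nu>\<close> yields the product of
  second fundamental form coefficients.\<close>

lemma third_partial_tangent:
  assumes p: "p \<in> U"
  shows "lorentz_inner (partial l (partial i (tangent j)) p) (tangent m p)
    = (partial l (chris 1 i j) p + chris 1 i j p * chris 1 l 1 p + chris 2 i j p * chris 1 l 2 p) * metric 1 m p
    + (partial l (chris 2 i j) p + chris 1 i j p * chris 2 l 1 p + chris 2 i j p * chris 2 l 2 p) * metric 2 m p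
    - second_form i j p * second_form l m p"
proof -
  note d = differentiable_christoffel[OF p] differentiable_tangent[OF p] differentiable_normal[OF p]
  have d2: "second_form i j differentiable (at p)"
    unfolding second_form_def[abs_def]
    by (intro differentiable_lorentz_inner differentiable_tangent2 differentiable_normal p)
  have "partial l (partial i (tangent j)) p
    = partial l (\<lambda>q. chris 1 i j q *\<^sub>R tangent 1 q + chris 2 i j q *\<^sub>R tangent 2 q + second_form i j q *\<^sub>R \<nu> q) p"
    by (rule partial_cong_open[OF open_domain p differentiable_tangent2[OF p] gauss_formula])
  also have "\<dots> = (partial l (chris 1 i j) p *\<^sub>R tangent 1 p + chris 1 i j p *\<^sub>R partial l (tangent 1) p)
    + (partial l (chris 2 i j) p *\<^sub>R tangent 2 p + chris 2 i j p *\<^sub>R partial l (tangent 2) p)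
    + (partial l (second_form i j) p *\<^sub>R \<nu> p + second_form i j p *\<^sub>R partial l \<nu> p)"
    by (simp add: partial_add partial_scaleR d d2 differentiable_scaleR differentiable_add)
  finally show ?thesis
    by (simp add: lorentz.add_left lorentz.scaleR_left normal_tangent[OF p] partial_normal_tangent[OF p]
        christoffel_lower[OF p, symmetric] algebra_simps)
qed

text \<open>Compare the components along \<open>tangent 1\<close> of the third derivatives of
  \<open>h\<close> taken in two orders. The Christoffel terms of the difference assemble to the
  curvature tensor; what remains is the determinant of the second fundamental form.\<close>

lemma gauss_equation:
  assumes p: "p \<in> U"
  shows "gaussian_curvature h p * (metric 1 1 p * metric 2 2 p - (metric 1 2 p)\<^sup>2)
    = second_form 1 1 p * second_form 2 2 p - (second_form 1 2 p)\<^sup>2"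
proof -
  have "partial 1 (partial 2 (tangent 2)) p = partial 2 (partial 1 (tangent 2)) p"
    by (rule partial_commute[OF open_domain p smooth_on_partial[OF smooth_immersion]])
  then have "lorentz_inner (partial 1 (partial 2 (tangent 2)) p) (tangent 1 p)
      = lorentz_inner (partial 2 (partial 1 (tangent 2)) p) (tangent 1 p)"
    by simp
  then have "metric 1 1 p * riemann metric_matrix 1 1 2 2 p + metric 2 1 p * riemann metric_matrix 2 1 2 2 p
    = second_form 1 1 p * second_form 2 2 p - (second_form 1 2 p)\<^sup>2"
    unfolding third_partial_tangent[OF p] riemann_def sum_2 second_form_commute[OF p, of 2 1]
    by (simp add: power2_eq_square algebra_simps)
  then show ?thesis
    using det_metric_nonzero[OF p]
    unfolding gaussian_curvature_def metric_curvature_def sum_2 det_metric_matrix metric_matrix_nth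
    by simp
qed

end

section \<open>The shape operator\<close>

lemma linear_plane_nth:
  fixes A :: "real^2 \<Rightarrow> real^2"
  assumes "linear A"
  shows "A v $ i = matrix A $ i $ 1 * v $ 1 + matrix A $ i $ 2 * v $ 2"
proof -
  have "A v = matrix A *v v" using assms by (simp add: matrix_works)
  then show ?thesis by (simp add: matrix_vector_mult_def sum_2)
qed

lemma characteristic_poly_eq:
  "characteristic_poly A =
    [: matrix A $ 1 $ 1 * matrix A $ 2 $ 2 - matrix A $ 1 $ 2 * matrix A $ 2 $ 1,
       - (matrix A $ 1 $ 1 + matrix A $ 2 $ 2), 1 :]"
  by (simp add: characteristic_poly_def det_2 mat_def)

text \<open>A double root is also a root of the derivative, which gives the trace; the polynomial
  itself then gives the determinant. Conversely these two values make the polynomial the square of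
  \<open>[:-c, 1:]\<close>.\<close>

lemma order_characteristic_poly_eq_2_iff:
  "order c (characteristic_poly A) = 2 \<longleftrightarrow>
    matrix A $ 1 $ 1 + matrix A $ 2 $ 2 = 2 * c \<and>
    matrix A $ 1 $ 1 * matrix A $ 2 $ 2 - matrix A $ 1 $ 2 * matrix A $ 2 $ 1 = c\<^sup>2"
    (is "?L \<longleftrightarrow> ?tr = 2 * c \<and> ?det = c\<^sup>2")
proof
  assume ?L
  then have "[:-c, 1:] ^ 2 dvd characteristic_poly A"
    using order_1[of c "characteristic_poly A"] by simp
  then obtain q where "characteristic_poly A = [:-c, 1:] ^ 2 * q" by (rule dvdE)
  moreover define l where "l = [:-c, 1:]"
  ultimately have q: "characteristic_poly A = l * l * q" by (simp add: power2_eq_square)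
  have l: "poly l c = 0" by (simp add: l_def)
  then have "poly (characteristic_poly A) c = 0"
    by (simp add: q)
  moreover have "poly (pderiv (characteristic_poly A)) c = 0"
    by (simp add: q l pderiv_mult)
  ultimately show "?tr = 2 * c \<and> ?det = c\<^sup>2"
    unfolding characteristic_poly_eq by (simp add: pderiv_pCons power2_eq_square) algebra
next
  assume "?tr = 2 * c \<and> ?det = c\<^sup>2"
  then have "characteristic_poly A = [:-c, 1:] ^ 2"
    unfolding characteristic_poly_eq by (simp add: power2_eq_square)
  then show ?L by (simp add: order_power_n_n)
qed

text \<open>The eigenvalue \<open>l\<close> of each vector in an eigenbasis is a root of the
  characteristic polynomial, so \<open>(l - c)\<^sup>2 = 0\<close>. Hence the map agrees with
  multiplication by \<open>c\<close> on a basis.\<close>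

lemma diagonalizable_double_eigenvalue:
  assumes A: "linear A" and "diagonalizable A"
    and tr: "matrix A $ 1 $ 1 + matrix A $ 2 $ 2 = 2 * c"
    and det: "matrix A $ 1 $ 1 * matrix A $ 2 $ 2 - matrix A $ 1 $ 2 * matrix A $ 2 $ 1 = c\<^sup>2"
  shows "A v = c *\<^sub>R v"
proof -
  obtain B where B: "independent B" "span B = UNIV" "\<And>b. b \<in> B \<Longrightarrow> \<exists>l. A b = l *\<^sub>R b"
    using assms(2) unfolding diagonalizable_def by blast
  have "A b = c *\<^sub>R b" if b: "b \<in> B" for b
  proof -
    obtain l where l: "A b = l *\<^sub>R b" using B(3)[OF b] by blast
    have nz: "b \<noteq> 0" using B(1) b dependent_zero by blast
    have e: "l * b $ i = matrix A $ i $ 1 * b $ 1 + matrix A $ i $ 2 * b $ 2" for i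
      using linear_plane_nth[OF A, of b i] unfolding l by simp
    have "(l - c)\<^sup>2 * b $ 1 = 0" "(l - c)\<^sup>2 * b $ 2 = 0"
      using e[of 1] e[of 2] tr det by algebra+
    then have "l = c"
      using nz by (auto simp: vec_eq_iff forall_2)
    with l show ?thesis by simp
  qed
  then show ?thesis
    using linear_eq_on[OF A, of "(*\<^sub>R) c" v B] B(2) by simp
qed

section \<open>Shape operator and null principal directions\<close>

context timelike_immersion
begin

text \<open>An explicit solution is built and injectivity of the differential of \<open>h\<close>
  makes it unique, so the definite description denotes it.\<close>

lemma shape_operator_works:
  assumes p: "p \<in> U"
  shows "linear (shape_operator h \<nu> p)"
    and "frechet_derivative \<nu> (at p) v = - frechet_derivative h (at p) (shape_operator h \<nu> p v)"
proof -
  let ?dh = "frechet_derivative h (at p)" and ?dn = "frechet_derivative \<nu> (at p)"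
  let ?d = "metric 1 1 p * metric 2 2 p - (metric 1 2 p)\<^sup>2"
  note dh = frechet_derivative_eq_partials[OF differentiable_immersion[OF p]]
  note dn = frechet_derivative_eq_partials[OF differentiable_normal[OF p]]
  \<comment> \<open>The products that \<open>dh (A v)\<close> must have with the tangents. Cramer's
    rule for the Gram matrix then yields the coordinates of \<open>A v\<close>.\<close>
  define x where "x l v = - lorentz_inner (?dn v) (tangent l p)" for l v
  define A :: "real^2 \<Rightarrow> real^2" where
    "A v = vector [(x 1 v * metric 2 2 p - x 2 v * metric 1 2 p) / ?d,
                   (x 2 v * metric 1 1 p - x 1 v * metric 1 2 p) / ?d]" for v
  have A_nth: "A v $ 1 = (x 1 v * metric 2 2 p - x 2 v * metric 1 2 p) / ?d"
    "A v $ 2 = (x 2 v * metric 1 1 p - x 1 v * metric 1 2 p) / ?d" for v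
    by (simp_all add: A_def)
  have "linear ?dn" using differentiable_normal[OF p] by (rule linear_frechet_derivative)
  then have x: "x l (v + w) = x l v + x l w" "x l (c *\<^sub>R v) = c * x l v" for l v w c
    by (simp_all add: x_def linear_add linear_cmul lorentz.add_left lorentz.scaleR_left)
  have "linear A"
    by (rule linearI)
      (simp_all add: vec_eq_iff forall_2 A_nth x add_divide_distrib diff_divide_distrib algebra_simps)
  moreover have "?dn v = - ?dh (A v)" for v
  proof -
    have "?d * A v $ 1 = x 1 v * metric 2 2 p - x 2 v * metric 1 2 p"
      "?d * A v $ 2 = x 2 v * metric 1 1 p - x 1 v * metric 1 2 p"
      using det_metric_nonzero[OF p] by (simp_all add: A_nth)
    then have "?d * (A v $ 1 * metric 1 1 p + A v $ 2 * metric 1 2 p) = ?d * x 1 v"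
      "?d * (A v $ 1 * metric 1 2 p + A v $ 2 * metric 2 2 p) = ?d * x 2 v"
      by algebra+
    then have "lorentz_inner (?dh (A v)) (tangent 1 p) = x 1 v"
      "lorentz_inner (?dh (A v)) (tangent 2 p) = x 2 v"
      using det_metric_nonzero[OF p]
      by (simp_all add: dh lorentz.add_left lorentz.scaleR_left metric_21)
    moreover have "lorentz_inner (?dn v) (\<nu> p) = 0"
      by (simp add: dn lorentz.add_left lorentz.scaleR_left partial_normal_normal[OF p])
    moreover have "lorentz_inner (?dh (A v)) (\<nu> p) = 0"
      using normal_tangent[OF p]
      by (simp add: dh lorentz.add_left lorentz.scaleR_left lorentz_inner_commute[of "tangent _ p" "\<nu> p"])
    ultimately have "?dn v + ?dh (A v) = 0"
      unfolding tangent_normal_eq_zero_iff[OF p] by (simp add: lorentz.add_left x_def)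
    then show ?thesis by (rule eq_neg_iff_add_eq_0[THEN iffD2])
  qed
  moreover have "B = A" if B: "\<forall>v. ?dn v = - ?dh (B v)" for B
  proof
    fix v
    have "?dh (B v) = ?dh (A v)"
      using B \<open>\<And>v. ?dn v = - ?dh (A v)\<close> by (metis neg_equal_iff_equal)
    then show "B v = A v"
      using timelike p unfolding timelike_surface_def by (blast dest: injD)
  qed
  ultimately have "\<exists>!A. linear A \<and> (\<forall>v. ?dn v = - ?dh (A v))"
    by blast
  from theI'[OF this]
  show "linear (shape_operator h \<nu> p)" "?dn v = - ?dh (shape_operator h \<nu> p v)"
    unfolding shape_operator_def by blast+
qed

text \<open>The right-hand side is symmetric in \<open>v\<close> and \<open>w\<close>: this is how
  self-adjointness of the shape operator enters.\<close>

lemma induced_metric_shape_operator: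
  assumes p: "p \<in> U"
  shows "induced_metric h p (shape_operator h \<nu> p v) w
    = v$1 * w$1 * second_form 1 1 p + (v$1 * w$2 + v$2 * w$1) * second_form 1 2 p + v$2 * w$2 * second_form 2 2 p"
proof -
  have "induced_metric h p (shape_operator h \<nu> p v) w
    = - lorentz_inner (frechet_derivative \<nu> (at p) v) (frechet_derivative h (at p) w)"
    unfolding induced_metric_def shape_operator_works(2)[OF p, of v] by (simp add: lorentz.minus_left)
  then show ?thesis
    by (simp add: frechet_derivative_eq_partials[OF differentiable_immersion[OF p]]
        frechet_derivative_eq_partials[OF differentiable_normal[OF p]]
        lorentz.add_left lorentz.add_right lorentz.scaleR_left lorentz.scaleR_right
        partial_normal_tangent[OF p] second_form_commute[OF p, of 2 1] algebra_simps)
qed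

text \<open>The orthogonal complement of a null vector \<open>X\<close> is its own span, so the
  functional pairing with \<open>X\<close> is a multiple of the determinant against
  \<open>X\<close>. Self-adjointness then makes the operator act by \<open>k\<close> on the quotient
  by \<open>X\<close> as well as on \<open>X\<close>, so \<open>k\<close> is a double
  eigenvalue.\<close>

lemma null_principal_direction:
  assumes p: "p \<in> U" and X: "X \<noteq> 0" "shape_operator h \<nu> p X = k *\<^sub>R X"
    and null: "induced_metric h p X X = 0"
  shows "umbilic h \<nu> p \<or> quasi_umbilic h \<nu> p"
proof -
  let ?A = "shape_operator h \<nu> p"
  let ?a = "\<lambda>i j. matrix ?A $ i $ j"
  \<comment> \<open>The coefficient vector of the functional that pairs with \<open>X\<close> in the
    induced metric.\<close>
  define y :: "real^2" where "y = vector [metric 1 1 p * X$1 + metric 1 2 p * X$2, metric 1 2 p * X$1 + metric 2 2 p * X$2]"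
  define n where "n = (X$1)\<^sup>2 + (X$2)\<^sup>2"
  define c where "c = (X$1 * y$2 - X$2 * y$1) / n"
  have y: "y$1 = metric 1 1 p * X$1 + metric 1 2 p * X$2" "y$2 = metric 1 2 p * X$1 + metric 2 2 p * X$2"
    by (simp_all add: y_def)
  have B: "induced_metric h p v X = v$1 * y$1 + v$2 * y$2" for v
    unfolding induced_metric_eq[OF p] y by (simp add: algebra_simps)
  have n: "n \<noteq> 0"
    using X(1) by (simp add: n_def vec_eq_iff forall_2 sum_power2_eq_zero_iff)
  \<comment> \<open>Nullity makes \<open>y\<close> Euclidean-orthogonal to \<open>X\<close>, so
    \<open>y\<close> is \<open>c\<close> times \<open>X\<close> rotated by a quarter turn.\<close>
  have "c * n = X$1 * y$2 - X$2 * y$1" using n by (simp add: c_def)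
  moreover have "X$1 * y$1 + X$2 * y$2 = 0" using null B[of X] by simp
  ultimately have "n * y$1 = n * (- c * X$2)" "n * y$2 = n * (c * X$1)"
    unfolding n_def by algebra+
  then have yX: "y$1 = - c * X$2" "y$2 = c * X$1" by (simp_all only: mult_left_cancel[OF n])
  \<comment> \<open>Otherwise \<open>X\<close> would lie in the kernel of the nondegenerate
    metric.\<close>
  have c: "c \<noteq> 0"
  proof
    assume "c = 0"
    with yX y have "metric 1 1 p * X$1 + metric 1 2 p * X$2 = 0" "metric 1 2 p * X$1 + metric 2 2 p * X$2 = 0"
      by simp_all
    then have "(metric 1 1 p * metric 2 2 p - (metric 1 2 p)\<^sup>2) * X$1 = 0"
      "(metric 1 1 p * metric 2 2 p - (metric 1 2 p)\<^sup>2) * X$2 = 0"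
      by algebra+
    then show False
      using det_metric_nonzero[OF p] X(1) by (simp add: vec_eq_iff forall_2)
  qed
  note nth = linear_plane_nth[OF shape_operator_works(1)[OF p]]
  have eig: "?a 1 1 * X$1 + ?a 1 2 * X$2 = k * X$1" "?a 2 1 * X$1 + ?a 2 2 * X$2 = k * X$2"
    using nth[of X 1] nth[of X 2] unfolding X(2) by simp_all
  have "induced_metric h p (?A v) X = induced_metric h p (?A X) v" for v
    unfolding induced_metric_shape_operator[OF p] by (simp add: algebra_simps)
  also have "induced_metric h p (?A X) v = k * induced_metric h p v X" for v
    unfolding X(2) induced_metric_eq[OF p] by (simp add: algebra_simps)
  finally have "?A v $ 1 * y$1 + ?A v $ 2 * y$2 = k * (v$1 * y$1 + v$2 * y$2)" for v
    unfolding B .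
  then have "c * (?A v $ 2 * X$1 - ?A v $ 1 * X$2) = c * (k * (v$2 * X$1 - v$1 * X$2))" for v
    unfolding yX by (simp add: algebra_simps)
  then have adj: "?A v $ 2 * X$1 - ?A v $ 1 * X$2 = k * (v$2 * X$1 - v$1 * X$2)" for v
    using c by simp
  have adj1: "?a 2 1 * X$1 - ?a 1 1 * X$2 = - k * X$2" and adj2: "?a 2 2 * X$1 - ?a 1 2 * X$2 = k * X$1"
    using adj[of "axis 1 1"] adj[of "axis 2 1"] by (simp_all add: nth axis_def)
  \<comment> \<open>Each identity is multiplied by both coordinates of \<open>X\<close>, since only
    one of them need be nonzero.\<close>
  have "X$1 * (?a 1 1 + ?a 2 2) = X$1 * (2 * k)" "X$2 * (?a 1 1 + ?a 2 2) = X$2 * (2 * k)"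
    "X$1 * (?a 1 1 * ?a 2 2 - ?a 1 2 * ?a 2 1) = X$1 * k\<^sup>2" "X$2 * (?a 1 1 * ?a 2 2 - ?a 1 2 * ?a 2 1) = X$2 * k\<^sup>2"
    using eig adj1 adj2 by algebra+
  then have tr: "?a 1 1 + ?a 2 2 = 2 * k" and det: "?a 1 1 * ?a 2 2 - ?a 1 2 * ?a 2 1 = k\<^sup>2"
    using X(1) by (auto simp: vec_eq_iff forall_2)
  then have "order k (characteristic_poly ?A) = 2"
    unfolding order_characteristic_poly_eq_2_iff by blast
  moreover have "umbilic h \<nu> p" if "diagonalizable ?A"
    unfolding umbilic_def
    using diagonalizable_double_eigenvalue[OF shape_operator_works(1)[OF p] that tr det] by blast
  ultimately show ?thesis
    unfolding quasi_umbilic_def by blast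
qed

text \<open>The matrix of the second fundamental form is the transpose of \<open>a\<close> times the
  metric matrix. Take determinants and cancel against the Gauss equation.\<close>

lemma gaussian_curvature_eq_det:
  assumes p: "p \<in> U"
  defines "a \<equiv> matrix (shape_operator h \<nu> p)"
  shows "gaussian_curvature h p = a $ 1 $ 1 * a $ 2 $ 2 - a $ 1 $ 2 * a $ 2 $ 1"
proof -
  let ?A = "shape_operator h \<nu> p"
  note nth = linear_plane_nth[OF shape_operator_works(1)[OF p], folded a_def]
  have "induced_metric h p (?A (axis i 1)) (axis j 1) = a $ 1 $ i * metric 1 j p + a $ 2 $ i * metric 2 j p" for i j
    using exhaust_2[of i] exhaust_2[of j]
    by (auto simp: induced_metric_eq[OF p] nth axis_def metric_21)
  from this[of 1 1] this[of 1 2] this[of 2 1] this[of 2 2]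
  have b: "second_form 1 1 p = a $ 1 $ 1 * metric 1 1 p + a $ 2 $ 1 * metric 1 2 p"
    "second_form 1 2 p = a $ 1 $ 1 * metric 1 2 p + a $ 2 $ 1 * metric 2 2 p"
    "second_form 1 2 p = a $ 1 $ 2 * metric 1 1 p + a $ 2 $ 2 * metric 1 2 p"
    "second_form 2 2 p = a $ 1 $ 2 * metric 1 2 p + a $ 2 $ 2 * metric 2 2 p"
    unfolding induced_metric_shape_operator[OF p]
    by (simp_all add: axis_def metric_21)
  have "second_form 1 1 p * second_form 2 2 p - (second_form 1 2 p)\<^sup>2
    = (a $ 1 $ 1 * a $ 2 $ 2 - a $ 1 $ 2 * a $ 2 $ 1) * (metric 1 1 p * metric 2 2 p - (metric 1 2 p)\<^sup>2)"
    using b by algebra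
  then show ?thesis
    using gauss_equation[OF p] det_metric_nonzero[OF p] by simp
qed

lemma negative_curvature_not_quasi_umbilic:
  assumes "p \<in> U" "gaussian_curvature h p < 0"
  shows "\<not> quasi_umbilic h \<nu> p"
proof
  assume "quasi_umbilic h \<nu> p"
  then obtain c where "gaussian_curvature h p = c\<^sup>2"
    unfolding quasi_umbilic_def order_characteristic_poly_eq_2_iff gaussian_curvature_eq_det[OF assms(1)]
    by blast
  with assms(2) show False by (simp add: not_less[symmetric])
qed

end

section \<open>The index of a line field\<close>

text \<open>The generator is chosen point by point, with no claim of continuity: a line field need
  not have a global continuous section.\<close>

lemma continuous_line_field_on_generator:
  assumes "continuous_line_field_on S F"
  obtains Y where "\<And>p. p \<in> S \<Longrightarrow> Y p \<noteq> 0" "\<And>p. p \<in> S \<Longrightarrow> F p = span {Y p}"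
proof -
  have "\<exists>x. x \<noteq> 0 \<and> F p = span {x}" if p: "p \<in> S" for p
  proof -
    from assms[unfolded continuous_line_field_on_def, rule_format, OF p]
    obtain N X where "p \<in> N" "\<forall>q\<in>N \<inter> S. X q \<noteq> 0 \<and> F q = span {X q}"
      by blast
    with p have "X p \<noteq> 0 \<and> F p = span {X p}" by simp
    then show ?thesis ..
  qed
  then show thesis using that by metis
qed

lemma continuous_line_field_on_subset:
  assumes "continuous_line_field_on S F" "T \<subseteq> S"
  shows "continuous_line_field_on T F"
  unfolding continuous_line_field_on_def
proof
  fix p assume "p \<in> T"
  then have "p \<in> S" using assms(2) by blast
  from assms(1)[unfolded continuous_line_field_on_def, rule_format, OF this]
  obtain N X where N: "open N" "p \<in> N" and X: "continuous_on (N \<inter> S) X"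
    "\<forall>q\<in>N \<inter> S. X q \<noteq> 0 \<and> F q = span {X q}"
    by blast
  have sub: "N \<inter> T \<subseteq> N \<inter> S" using assms(2) by blast
  show "\<exists>N X. open N \<and> p \<in> N \<and> continuous_on (N \<inter> T) X \<and>
      (\<forall>q\<in>N \<inter> T. X q \<noteq> 0 \<and> F q = span {X q})"
    by (rule exI[of _ N], rule exI[of _ X])
      (intro conjI N continuous_on_subset[OF X(1) sub] ballI bspec[OF X(2)] subsetD[OF sub])
qed

text \<open>A local section of a line field is only determined up to a nonzero factor, so functions that are
  homogeneous of degree zero in the direction vector do not depend on the choice of section.\<close>

lemma continuous_on_homogeneous_line_field:
  fixes \<phi> :: "real^2 \<Rightarrow> real^2 \<Rightarrow> 'b::topological_space"
  assumes F: "continuous_line_field_on S F"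
    and Y: "\<And>p. p \<in> S \<Longrightarrow> F p = span {Y p}"
    and hom: "\<And>p x c. p \<in> S \<Longrightarrow> c \<noteq> 0 \<Longrightarrow> \<phi> p (c *\<^sub>R x) = \<phi> p x"
    and cont: "\<And>T X. T \<subseteq> S \<Longrightarrow> continuous_on T X \<Longrightarrow> (\<And>q. q \<in> T \<Longrightarrow> X q \<noteq> 0 \<and> F q = span {X q}) \<Longrightarrow>
      continuous_on T (\<lambda>q. \<phi> q (X q))"
  shows "continuous_on S (\<lambda>p. \<phi> p (Y p))"
  unfolding continuous_on_eq_continuous_within
proof
  fix p assume p: "p \<in> S"
  obtain N X where N: "open N" "p \<in> N" and X: "continuous_on (N \<inter> S) X"
    "\<And>q. q \<in> N \<inter> S \<Longrightarrow> X q \<noteq> 0 \<and> F q = span {X q}"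
    using F[unfolded continuous_line_field_on_def, rule_format, OF p] by blast
  have "\<phi> q (X q) = \<phi> q (Y q)" if q: "q \<in> N \<inter> S" for q
  proof -
    have "X q \<in> span {Y q}" using X(2)[OF q] Y[of q] q span_base[of "X q" "{X q}"] by simp
    then obtain c where "X q = c *\<^sub>R Y q" by (auto simp: span_singleton)
    moreover from this have "c \<noteq> 0" using X(2)[OF q] by auto
    ultimately show ?thesis using hom[of q c "Y q"] q by simp
  qed
  moreover have "continuous_on (N \<inter> S) (\<lambda>q. \<phi> q (X q))"
    by (rule cont[OF _ X]) auto
  ultimately have "continuous_on (N \<inter> S) (\<lambda>q. \<phi> q (Y q))"
    by (rule continuous_on_eq[rotated])
  then have "continuous (at p within N \<inter> S) (\<lambda>q. \<phi> q (Y q))"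
    using p N by (simp add: continuous_on_eq_continuous_within)
  moreover have "at p within N \<inter> S = at p within S"
    by (rule at_within_nhd[OF N(2,1)]) auto
  ultimately show "continuous (at p within S) (\<lambda>q. \<phi> q (Y q))"
    by simp
qed

section \<open>Angle functions and vanishing of the index\<close>

lemma span_singleton_scaleR:
  assumes "c \<noteq> (0::real)"
  shows "span {c *\<^sub>R x} = span {x}"
proof -
  have "range (\<lambda>k. k *\<^sub>R c *\<^sub>R x) = range (\<lambda>k. k *\<^sub>R x)"
  proof (intro equalityI subsetI)
    fix y assume "y \<in> range (\<lambda>k. k *\<^sub>R x)"
    then obtain k where "y = k *\<^sub>R x" by blast
    then have "y = (k / c) *\<^sub>R c *\<^sub>R x" using assms by simp
    then show "y \<in> range (\<lambda>k. k *\<^sub>R c *\<^sub>R x)" by blast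
  qed auto
  then show ?thesis by (simp add: span_singleton)
qed

lemma exists_angle_vec: "\<exists>\<alpha>. norm v *\<^sub>R angle_vec \<alpha> = v"
proof (cases "v = 0")
  case False
  have "(v$1)\<^sup>2 + (v$2)\<^sup>2 = (norm v)\<^sup>2"
    by (simp add: norm_vec_def L2_set_def sum_2)
  then have "(v$1 / norm v)\<^sup>2 + (v$2 / norm v)\<^sup>2 = 1"
    using False by (simp add: power_divide flip: add_divide_distrib)
  then obtain t where "cos t = v$1 / norm v" "sin t = v$2 / norm v"
    using sincos_total_2pi by metis
  then have "norm v *\<^sub>R angle_vec t = v"
    using False by (simp add: angle_vec_def vec_eq_iff forall_2)
  then show ?thesis by blast
qed simp

lemma angle_vec_orthogonal_basis:
  "(x \<bullet> angle_vec \<alpha>) *\<^sub>R angle_vec \<alpha> + (x \<bullet> angle_vec (\<alpha> + pi/2)) *\<^sub>R angle_vec (\<alpha> + pi/2) = x"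
proof -
  have "(x$1 * cos \<alpha> + x$2 * sin \<alpha>) * cos \<alpha> - (x$2 * cos \<alpha> - x$1 * sin \<alpha>) * sin \<alpha>
      = x$1 * ((sin \<alpha>)\<^sup>2 + (cos \<alpha>)\<^sup>2)"
    "(x$1 * cos \<alpha> + x$2 * sin \<alpha>) * sin \<alpha> + (x$2 * cos \<alpha> - x$1 * sin \<alpha>) * cos \<alpha>
      = x$2 * ((sin \<alpha>)\<^sup>2 + (cos \<alpha>)\<^sup>2)"
    unfolding power2_eq_square by (simp_all only: algebra_simps)
  then show ?thesis
    by (simp add: vec_eq_iff forall_2 angle_vec_def inner_vec_def sum_2 sin_add cos_add)
qed

text \<open>In the orthonormal basis \<open>?e\<close>, \<open>?f\<close>, a line that misses
  \<open>?e\<close> has nonzero \<open>?f\<close>-component, so its inverse slope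
  \<open>\<sigma>\<close> is finite, continuous and independent of the generator. The line is
  spanned by \<open>\<sigma> p *\<^sub>R ?e + ?f\<close>, which is turned from \<open>?f\<close>
  towards \<open>?e\<close> by \<open>arctan (\<sigma> p)\<close>.\<close>

lemma continuous_angle_of_avoiding_line_field:
  assumes F: "continuous_line_field_on S F" and avoid: "\<And>p. p \<in> S \<Longrightarrow> angle_vec \<alpha> \<notin> F p"
  obtains \<Theta> where "continuous_on S \<Theta>" "\<And>p. p \<in> S \<Longrightarrow> F p = span {angle_vec (\<Theta> p)}"
proof -
  let ?e = "angle_vec \<alpha>" and ?f = "angle_vec (\<alpha> + pi/2)"
  obtain Y where Y: "\<And>p. p \<in> S \<Longrightarrow> Y p \<noteq> 0" "\<And>p. p \<in> S \<Longrightarrow> F p = span {Y p}"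
    by (rule continuous_line_field_on_generator[OF F]) (rule that)
  have nz: "x \<bullet> ?f \<noteq> 0" if "p \<in> S" "x \<noteq> 0" "F p = span {x}" for p x
  proof
    assume "x \<bullet> ?f = 0"
    then have x: "(x \<bullet> ?e) *\<^sub>R ?e = x"
      using angle_vec_orthogonal_basis[of x \<alpha>] by simp
    then have "x \<bullet> ?e \<noteq> 0" using that(2) by force
    from span_singleton_scaleR[OF this, of ?e] have "span {x} = span {?e}"
      unfolding x .
    then show False using avoid[OF that(1)] that(3) by (simp add: span_base)
  qed
  define \<sigma> where "\<sigma> p = (Y p \<bullet> ?e) / (Y p \<bullet> ?f)" for p
  have "continuous_on S (\<lambda>p. (\<lambda>p x. (x \<bullet> ?e) / (x \<bullet> ?f)) p (Y p))"
  proof (rule continuous_on_homogeneous_line_field[OF F Y(2)])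
    fix T X assume T: "T \<subseteq> S" "continuous_on T X" "\<And>q. q \<in> T \<Longrightarrow> X q \<noteq> 0 \<and> F q = span {X q}"
    then show "continuous_on T (\<lambda>q. (X q \<bullet> ?e) / (X q \<bullet> ?f))"
      using nz by (intro continuous_on_divide continuous_on_inner continuous_on_const) blast+
  qed auto
  then have \<sigma>: "continuous_on S \<sigma>" by (simp add: \<sigma>_def[abs_def])
  show thesis
  proof
    show "continuous_on S (\<lambda>p. \<alpha> + pi/2 - arctan (\<sigma> p))"
      by (intro continuous_intros \<sigma>)
    fix p assume p: "p \<in> S"
    let ?b = "Y p \<bullet> ?f" and ?r = "sqrt (1 + (\<sigma> p)\<^sup>2)"
    have b: "?b \<noteq> 0" using nz p Y by blast
    have r: "?r \<noteq> 0" by (simp add: add_nonneg_eq_0_iff)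
    have "angle_vec (\<alpha> + pi/2 - arctan (\<sigma> p)) = (1 / ?r) *\<^sub>R (\<sigma> p *\<^sub>R ?e + ?f)"
      by (simp add: angle_vec_def vec_eq_iff forall_2 cos_diff sin_diff cos_add sin_add
          cos_arctan sin_arctan add_divide_distrib diff_divide_distrib)
    also have "\<dots> = (1 / (?r * ?b)) *\<^sub>R (?b *\<^sub>R (\<sigma> p *\<^sub>R ?e + ?f))"
      using b by simp
    also have "?b *\<^sub>R (\<sigma> p *\<^sub>R ?e + ?f) = Y p"
      using b angle_vec_orthogonal_basis[of "Y p" \<alpha>] by (simp add: \<sigma>_def scaleR_add_right)
    finally have "span {angle_vec (\<alpha> + pi/2 - arctan (\<sigma> p))} = span {Y p}"
      using b r span_singleton_scaleR[of "1 / (?r * ?b)" "Y p"] by simp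
    then show "F p = span {angle_vec (\<alpha> + pi/2 - arctan (\<sigma> p))}"
      using Y(2)[OF p] by simp
  qed
qed

lemma has_line_field_index_zeroI:
  assumes "\<epsilon> > 0" and F: "continuous_line_field_on (ball p \<epsilon> - {p}) F"
    and "v \<noteq> 0" and avoid: "\<And>q. q \<in> ball p \<epsilon> - {p} \<Longrightarrow> v \<notin> F q"
  shows "has_line_field_index F p 0"
proof -
  obtain \<alpha> where \<alpha>: "norm v *\<^sub>R angle_vec \<alpha> = v" using exists_angle_vec by blast
  obtain Y where "\<And>q. q \<in> ball p \<epsilon> - {p} \<Longrightarrow> Y q \<noteq> 0"
    and Y: "\<And>q. q \<in> ball p \<epsilon> - {p} \<Longrightarrow> F q = span {Y q}"
    by (rule continuous_line_field_on_generator[OF F]) (rule that)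
  have sub: "subspace (F q)" if "q \<in> ball p \<epsilon> - {p}" for q
    using Y[OF that] by simp
  have avoid': "angle_vec \<alpha> \<notin> F q" if "q \<in> ball p \<epsilon> - {p}" for q
    using avoid[OF that] subspace_scale[OF sub[OF that], of "angle_vec \<alpha>" "norm v"] \<alpha> by auto
  obtain \<Theta> where \<Theta>: "continuous_on (ball p \<epsilon> - {p}) \<Theta>"
    "\<And>q. q \<in> ball p \<epsilon> - {p} \<Longrightarrow> F q = span {angle_vec (\<Theta> q)}"
    by (rule continuous_angle_of_avoiding_line_field[OF F], erule avoid', rule that)
  have norm1: "norm (angle_vec t) = 1" for t
    by (simp add: norm_vec_def L2_set_def angle_vec_def sum_2)
  have "angle_vec t = cos t *\<^sub>R axis 1 1 + sin t *\<^sub>R axis 2 1" for t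
    by (simp add: angle_vec_def vec_eq_iff forall_2 axis_def)
  then have cont: "continuous_on T (\<lambda>t. p + r *\<^sub>R angle_vec t)" for T r
    by (simp only: continuous_intros)
  show ?thesis
    unfolding has_line_field_index_def
  proof (intro exI[of _ \<epsilon>] conjI allI impI \<open>\<epsilon> > 0\<close>)
    fix r assume r: "0 < r \<and> r < \<epsilon>"
    have circle: "p + r *\<^sub>R angle_vec t \<in> ball p \<epsilon> - {p}" for t
      using r norm1[of t] by (auto simp: dist_norm)
    let ?\<theta> = "\<lambda>t. \<Theta> (p + r *\<^sub>R angle_vec t)"
    have "continuous_on {0..2*pi} ?\<theta>"
      by (rule continuous_on_compose2[OF \<Theta>(1) cont image_subsetI[OF circle]])
    moreover have "\<forall>t\<in>{0..2*pi}. F (p + r *\<^sub>R angle_vec t) = span {angle_vec (?\<theta> t)}"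
      using \<Theta>(2) circle by blast
    \<comment> \<open>The angle along the circle is a function of the point alone, and the circle
      closes up.\<close>
    moreover have "angle_vec (2*pi) = angle_vec 0"
      by (simp add: angle_vec_def)
    then have "0 = (?\<theta> (2*pi) - ?\<theta> 0) / (2*pi)"
      by simp
    ultimately show "\<exists>\<theta>. continuous_on {0..2*pi} \<theta> \<and>
        (\<forall>t\<in>{0..2*pi}. F (p + r *\<^sub>R angle_vec t) = span {angle_vec (\<theta> t)}) \<and>
        0 = (\<theta> (2*pi) - \<theta> 0) / (2*pi)"
      by (intro exI[of _ ?\<theta>] conjI)
  qed
qed

section \<open>Causal character of the curvature line flow\<close>

context timelike_immersion
begin

lemma continuous_on_induced_metric:
  assumes "T \<subseteq> U" "continuous_on T X" "continuous_on T Y"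
  shows "continuous_on T (\<lambda>p. induced_metric h p (X p) (Y p))"
proof -
  have t: "continuous_on T (tangent i)" for i
    using smooth_on_imp_continuous_on[OF smooth_on_partial[OF smooth_immersion]] assms(1)
    by (rule continuous_on_subset)
  have "continuous_on T (\<lambda>p. X p$1 * Y p$1 * metric 1 1 p + (X p$1 * Y p$2 + X p$2 * Y p$1) * metric 1 2 p
    + X p$2 * Y p$2 * metric 2 2 p)"
    by (intro continuous_intros lorentz.continuous_on t assms)
  then show ?thesis
    using assms(1) by (simp add: induced_metric_eq subset_iff cong: continuous_on_cong)
qed

lemma induced_metric_scaleR: "p \<in> U \<Longrightarrow> induced_metric h p (c *\<^sub>R v) (c *\<^sub>R v) = c\<^sup>2 * induced_metric h p v v"
  by (simp add: induced_metric_eq power2_eq_square algebra_simps)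

proposition curvature_line_flow_index_zero:
  assumes "0 \<in> U"
    and no_umbilic: "\<And>p. p \<in> U - {0} \<Longrightarrow> \<not> umbilic h \<nu> p"
    and no_quasi: "\<And>p. p \<in> U - {0} \<Longrightarrow> \<not> quasi_umbilic h \<nu> p"
    and flow: "curvature_line_flow h \<nu> (U - {0}) F"
  shows "has_line_field_index F 0 0"
proof -
  have F: "continuous_line_field_on (U - {0}) F"
    and pd: "\<And>p. p \<in> U - {0} \<Longrightarrow> principal_direction h \<nu> p (F p)"
    using flow by (auto simp: curvature_line_flow_def)
  obtain Y where Y: "\<And>p. p \<in> U - {0} \<Longrightarrow> Y p \<noteq> 0" "\<And>p. p \<in> U - {0} \<Longrightarrow> F p = span {Y p}"
    by (rule continuous_line_field_on_generator[OF F]) (rule that)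
  have nonnull: "induced_metric h p (Y p) (Y p) \<noteq> 0" if p: "p \<in> U - {0}" for p
  proof -
    obtain k where "\<forall>v\<in>F p. shape_operator h \<nu> p v = k *\<^sub>R v"
      using pd[OF p] unfolding principal_direction_def by blast
    then have "shape_operator h \<nu> p (Y p) = k *\<^sub>R Y p"
      using Y(2)[OF p] by (simp add: span_base)
    then show ?thesis
      using null_principal_direction[of p "Y p" k] p Y(1) no_umbilic no_quasi by blast
  qed
  obtain e1 e2 where e: "induced_metric h 0 e1 e1 = 1" "induced_metric h 0 e2 e2 = -1"
    using timelike \<open>0 \<in> U\<close> unfolding timelike_surface_def lorentzian_form_def by blast
  have "isCont (\<lambda>p. induced_metric h p v v) 0" for v
    using continuous_on_induced_metric[of U "\<lambda>_. v" "\<lambda>_. v"] open_domain \<open>0 \<in> U\<close>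
      continuous_on_eq_continuous_at by auto
  then have lim: "((\<lambda>p. induced_metric h p v v) \<longlongrightarrow> induced_metric h 0 v v) (nhds 0)" for v
    unfolding isCont_def
    by (rule tendsto_at_iff_tendsto_nhds[where g = "\<lambda>p. induced_metric h p v v", THEN iffD1])
  have "\<forall>\<^sub>F p in nhds 0. induced_metric h p e1 e1 > 0" "\<forall>\<^sub>F p in nhds 0. induced_metric h p e2 e2 < 0"
    using order_tendstoD(1)[OF lim[of e1], of 0] order_tendstoD(2)[OF lim[of e2], of 0] e by auto
  moreover have "\<forall>\<^sub>F p in nhds 0. p \<in> U"
    using open_domain \<open>0 \<in> U\<close> by (rule eventually_nhds_in_open)
  ultimately have "\<forall>\<^sub>F p in nhds 0. p \<in> U \<and> induced_metric h p e1 e1 > 0 \<and> induced_metric h p e2 e2 < 0"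
    by eventually_elim auto
  then obtain \<epsilon> where \<epsilon>: "\<epsilon> > 0"
    "\<And>p. dist p 0 < \<epsilon> \<Longrightarrow> p \<in> U \<and> induced_metric h p e1 e1 > 0 \<and> induced_metric h p e2 e2 < 0"
    unfolding eventually_nhds_metric by blast
  let ?S = "ball 0 \<epsilon> - {0 :: real^2}"
  have S: "?S \<subseteq> U - {0}" using \<epsilon>(2) by (auto simp: dist_commute)
  have FS: "continuous_line_field_on ?S F"
    using F S by (rule continuous_line_field_on_subset)
  \<comment> \<open>The sign of \<open>q\<close> is the causal type of the line. Dividing by the
    Euclidean square norm makes it homogeneous of degree zero, hence continuous although
    \<open>Y\<close> need not be.\<close>
  define q where "q p = induced_metric h p (Y p) (Y p) / (Y p \<bullet> Y p)" for p
  have "continuous_on ?S (\<lambda>p. (\<lambda>p x. induced_metric h p x x / (x \<bullet> x)) p (Y p))"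
  proof (rule continuous_on_homogeneous_line_field[OF FS])
    show "continuous_on T (\<lambda>q. induced_metric h q (X q) (X q) / (X q \<bullet> X q))"
      if "T \<subseteq> ?S" "continuous_on T X" "\<And>q. q \<in> T \<Longrightarrow> X q \<noteq> 0 \<and> F q = span {X q}" for T X
      using that S by (intro continuous_on_divide continuous_on_induced_metric continuous_on_inner) auto
  qed (use S Y induced_metric_scaleR in \<open>auto simp: power2_eq_square\<close>)
  then have "continuous_on ?S q" by (simp add: q_def[abs_def])
  moreover have "connected ?S"
    by (rule connected_punctured_ball) simp
  ultimately have "connected (q ` ?S)" by (rule connected_continuous_image)
  moreover have qnz: "q p \<noteq> 0" if "p \<in> ?S" for p
    using nonnull Y(1) S that by (auto simp: q_def)
  \<comment> \<open>The image of \<open>q\<close> is connected and misses 0, so it lies on one side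
    of 0.\<close>
  ultimately consider "\<And>p. p \<in> ?S \<Longrightarrow> q p > 0" | "\<And>p. p \<in> ?S \<Longrightarrow> q p < 0"
    by (smt (verit, ccfv_threshold) connectedD_interval imageE imageI)
  \<comment> \<open>A fixed vector of causal type opposite to that of the line field:
    \<open>e2\<close> for space-like lines, \<open>e1\<close> for time-like ones.\<close>
  then obtain v where v: "v \<noteq> 0"
    "\<And>p. p \<in> ?S \<Longrightarrow> induced_metric h p v v * q p < 0"
  proof cases
    case 1
    show thesis
    proof (rule that[of e2])
      show "e2 \<noteq> 0" using e(2) induced_metric_eq[OF \<open>0 \<in> U\<close>] by auto
      show "induced_metric h p e2 e2 * q p < 0" if "p \<in> ?S" for p
        using 1 \<epsilon>(2)[of p] that by (auto intro: mult_neg_pos simp: dist_commute)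
    qed
  next
    case 2
    show thesis
    proof (rule that[of e1])
      show "e1 \<noteq> 0" using e(1) induced_metric_eq[OF \<open>0 \<in> U\<close>] by auto
      show "induced_metric h p e1 e1 * q p < 0" if "p \<in> ?S" for p
        using 2 \<epsilon>(2)[of p] that by (auto intro: mult_pos_neg simp: dist_commute)
    qed
  qed
  show ?thesis
  proof (rule has_line_field_index_zeroI[OF \<epsilon>(1) FS v(1)])
    fix p assume p: "p \<in> ?S"
    then have pU: "p \<in> U - {0}" using S by blast
    show "v \<notin> F p"
    proof
      assume "v \<in> F p"
      then obtain c where "v = c *\<^sub>R Y p"
        using Y(2)[OF pU] by (auto simp: span_singleton)
      \<comment> \<open>A multiple of \<open>Y p\<close> would have the causal type of the line or
        be zero, contradicting the opposite signs.\<close>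
      then have "induced_metric h p v v * q p = (c * induced_metric h p (Y p) (Y p))\<^sup>2 / (Y p \<bullet> Y p)"
        using induced_metric_scaleR pU by (simp add: q_def power2_eq_square)
      then have "induced_metric h p v v * q p \<ge> 0" by simp
      then show False using v(2)[OF p] by simp
    qed
  qed
qed

end

theorem propositionD:
  fixes U :: "(real^2) set" and h \<nu> :: "real^2 \<Rightarrow> real^3" and F :: "real^2 \<Rightarrow> (real^2) set"
  assumes "0 \<in> U"
    and "timelike_surface h U"
    and "unit_normal_field h U \<nu>"
    and "\<forall>p\<in>U - {0}. \<not> umbilic h \<nu> p"
    and "curvature_line_flow h \<nu> (U - {0}) F"
  shows "((\<forall>p\<in>U - {0}. \<not> quasi_umbilic h \<nu> p) \<longrightarrow> has_line_field_index F 0 0) \<and>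
         ((\<forall>p\<in>U - {0}. gaussian_curvature h p < 0) \<longrightarrow> has_line_field_index F 0 0)"
proof -
  interpret timelike_immersion U h \<nu>
    using assms(2,3) by unfold_locales
  have "has_line_field_index F 0 0" if "\<forall>p\<in>U - {0}. \<not> quasi_umbilic h \<nu> p"
    using curvature_line_flow_index_zero assms(1,4,5) that by blast
  moreover have "\<forall>p\<in>U - {0}. \<not> quasi_umbilic h \<nu> p" if "\<forall>p\<in>U - {0}. gaussian_curvature h p < 0"
    using negative_curvature_not_quasi_umbilic that by blast
  ultimately show ?thesis by blast
qed

end
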